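(* Let $H$ be a complex Hilbert space with open unit ball $B_H$ and let $(x_n)_{n\in\mathbb{N}}$ be a sequence in $B_H$. Suppose that there exists $\delta>0$ such that $$\prod_{k\neq j}\rho_H(x_j,x_k)\ \geq\ \delta\qquad\text{for all } j\in\mathbb{N}.$$ Then there exists a sequence of Beurling functions $(F_n)$ for $(x_n)$, that is, there exist functions $F_j\in H^\infty(B_H)$ ($j\in\mathbb{N}$) and a constant $M>0$ such that $F_j(x_n)=\delta_{j,n}$ for all $j,n\in\mathbb{N}$ (where $\delta_{j,n}$ is the Kronecker delta) and $\sum_{j=1}^\infty |F_j(x)|\leq M$ for all $x\in B_H$. In particular, the sequence $(x_n)$ is interpolating for $H^\infty(B_H)$, and its constant of interpolation is bounded above by $$\frac{128\,\bigl(1+2\log\frac1\delta\bigr)}{e\,\delta}.$$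
   Context: $H^\infty(B_H)$ is the space of all bounded analytic (i.e. Fréchet differentiable in the complex sense) functions $f:B_H\to\mathbb{C}$, with the sup-norm $\|f\|_\infty=\sup_{x\in B_H}|f(x)|$. For $z,w$ in the open unit disc $\mathbf{D}\subset\mathbb{C}$, $\rho(z,w)=\left|\frac{z-w}{1-\overline{z}w}\right|$. The pseudohyperbolic distance on $B_H$ is $\rho_H(x,y)=\sup\{\rho(f(x),f(y)): f\in H^\infty(B_H),\ \|f\|_\infty\leq 1\}$; equivalently (a known fact) $\rho_H(x,y)^2=1-\frac{(1-\|x\|^2)(1-\|y\|^2)}{|1-\langle x,y\rangle|^2}$. A sequence $(x_n)\subset B_H$ is interpolating for $H^\infty(B_H)$ if for every $(a_n)\in\ell_\infty$ (bounded complex sequences) there exists $f\in H^\infty(B_H)$ with $f(x_n)=a_n$ for all $n\in\mathbb{N}$. For $\alpha=(\alpha_j)\in\ell_\infty$ let $M_\alpha=\inf\{\|f\|_\infty: f\in H^\infty(B_H),\ f(x_j)=\alpha_j \text{ for all } j\in\mathbb{N}\}$. The constant of interpolation of $(x_n)$ is $\sup\{M_\alpha:\alpha\in\ell_\infty,\ \|\alpha\|_\infty\leq1\}$. *)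

theory Defs
  imports "HOL-Analysis.Analysis"
begin

section \<open>Complex Hilbert spaces\<close>

class complex_vector = real_vector +
  fixes scaleC :: "complex \<Rightarrow> 'a \<Rightarrow> 'a" (infixr "*\<^sub>C" 75)
  assumes scaleC_add_right: "c *\<^sub>C (x + y) = c *\<^sub>C x + c *\<^sub>C y"
    and scaleC_add_left: "(c + d) *\<^sub>C x = c *\<^sub>C x + d *\<^sub>C x"
    and scaleC_scaleC: "c *\<^sub>C (d *\<^sub>C x) = (c * d) *\<^sub>C x"
    and scaleC_one: "1 *\<^sub>C x = x"
    and scaleR_scaleC: "r *\<^sub>R x = complex_of_real r *\<^sub>C x"

text \<open>The inner product is linear in its first argument.  The norm, and with it the metric and
  the topology, is the one induced by the inner product.\<close>

class complex_inner = complex_vector + real_normed_vector +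
  fixes cinner :: "'a \<Rightarrow> 'a \<Rightarrow> complex"
  assumes cinner_commute: "cinner x y = cnj (cinner y x)"
    and cinner_add_left: "cinner (x + y) z = cinner x z + cinner y z"
    and cinner_scaleC_left: "cinner (c *\<^sub>C x) y = c * cinner x y"
    and cinner_self: "cinner x x = complex_of_real ((norm x)\<^sup>2)"

class chilbert_space = complex_inner + complete_space

instantiation complex :: chilbert_space
begin

definition scaleC_complex :: "complex \<Rightarrow> complex \<Rightarrow> complex"
  where "scaleC_complex c x = c * x"

definition cinner_complex :: "complex \<Rightarrow> complex \<Rightarrow> complex"
  where "cinner_complex x y = x * cnj y"

instance
proof
  fix x :: complex
  show "cinner x x = complex_of_real ((norm x)\<^sup>2)"
    unfolding cinner_complex_def by (rule complex_norm_square [symmetric])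
qed (simp_all add: scaleC_complex_def cinner_complex_def distrib_left distrib_right
    scaleR_conv_of_real)

end


section \<open>Bounded analytic functions on the unit ball\<close>

text \<open>Functions on the ball are represented by functions on the whole space; their values outside
  the ball play no role.  Since \<open>has_derivative\<close> only provides a bounded real-linear
  derivative, complex homogeneity is required in addition.\<close>

definition cfrechet_differentiable_at :: "('a::complex_inner \<Rightarrow> complex) \<Rightarrow> 'a \<Rightarrow> bool"
  where "cfrechet_differentiable_at f x \<longleftrightarrow>
    (\<exists>L. (f has_derivative L) (at x) \<and> (\<forall>c h. L (c *\<^sub>C h) = c * L h))"

definition Hinf :: "('a::complex_inner \<Rightarrow> complex) set"
  where "Hinf = {f. (\<forall>x\<in>ball 0 1. cfrechet_differentiable_at f x) \<and> bounded (f ` ball 0 1)}"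

definition Hinf_norm :: "('a::complex_inner \<Rightarrow> complex) \<Rightarrow> real"
  where "Hinf_norm f = (SUP x\<in>ball 0 1. cmod (f x))"


section \<open>Pseudohyperbolic distance\<close>

definition pseudohyp :: "complex \<Rightarrow> complex \<Rightarrow> real"
  where "pseudohyp z w = cmod ((z - w) / (1 - cnj z * w))"

text \<open>The supremum also ranges over functions attaining modulus 1 inside the ball.  By the maximum
  principle these are the unimodular constants on the ball; they contribute the value
  \<open>0 / 0 = 0\<close> and so do not affect the supremum.\<close>

definition rho_H :: "'a::complex_inner \<Rightarrow> 'a \<Rightarrow> real"
  where "rho_H x y = (SUP f\<in>{f \<in> Hinf. Hinf_norm f \<le> 1}. pseudohyp (f x) (f y))"


section \<open>Interpolation\<close>

definition interpolating :: "(nat \<Rightarrow> 'a::complex_inner) \<Rightarrow> bool"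
  where "interpolating x \<longleftrightarrow>
    (\<forall>a :: nat \<Rightarrow> complex. bounded (range a) \<longrightarrow> (\<exists>f\<in>Hinf. \<forall>n. f (x n) = a n))"

text \<open>Infimum and supremum are taken in the extended reals, so that an empty infimum or an
  unbounded supremum is \<open>\<infinity>\<close>.\<close>

definition min_interpolation_norm :: "(nat \<Rightarrow> 'a::complex_inner) \<Rightarrow> (nat \<Rightarrow> complex) \<Rightarrow> ereal"
  where "min_interpolation_norm x \<alpha> =
    (INF f\<in>{f \<in> Hinf. \<forall>j. f (x j) = \<alpha> j}. ereal (Hinf_norm f))"

definition interpolation_constant :: "(nat \<Rightarrow> 'a::complex_inner) \<Rightarrow> ereal"
  where "interpolation_constant x =
    (SUP \<alpha>\<in>{\<alpha>. bounded (range \<alpha>) \<and> (SUP j. cmod (\<alpha> j)) \<le> 1}. min_interpolation_norm x \<alpha>)"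

definition beurling_functions ::
    "(nat \<Rightarrow> 'a::complex_inner) \<Rightarrow> (nat \<Rightarrow> 'a \<Rightarrow> complex) \<Rightarrow> bool"
  where "beurling_functions x F \<longleftrightarrow>
    (\<forall>j. F j \<in> Hinf) \<and>
    (\<forall>j n. F j (x n) = (if j = n then 1 else 0)) \<and>
    (\<exists>M>0. \<forall>z\<in>ball 0 1. summable (\<lambda>j. cmod (F j z)) \<and> (\<Sum>j. cmod (F j z)) \<le> M)"


section \<open>The separation condition\<close>

text \<open>The factors lie in \<open>[0, 1]\<close>, so the partial products always converge.  In the library's
  sense, however, a product whose partial products tend to 0 without a zero factor is not
  convergent and its \<open>prodinf\<close> is unspecified; convergence is therefore demanded explicitly.
  For \<open>\<delta> > 0\<close> this excludes nothing.\<close>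

definition uniformly_separated :: "real \<Rightarrow> (nat \<Rightarrow> 'a::complex_inner) \<Rightarrow> bool"
  where "uniformly_separated \<delta> x \<longleftrightarrow>
    (\<forall>j. convergent_prod (\<lambda>k. if k = j then 1 else rho_H (x j) (x k)) \<and>
         (\<Prod>k. if k = j then 1 else rho_H (x j) (x k)) \<ge> \<delta>)"

end

theory Submission
  imports Defs "HOL-Complex_Analysis.Complex_Analysis"
begin

text \<open>
Write \<open>d a = 1 - (norm a)\<^sup>2\<close>.  Restricting a function to the complex line through two points
and applying the Schwarz--Pick lemma to the disc in which this line meets the ball gives
\<open>rho_H a b \<le> sqrt (pseudohyp_sq a b)\<close> with
\<open>pseudohyp_sq a b = 1 - d a * d b / (cmod (1 - cinner a b))\<^sup>2\<close> (lemma \<open>rho_H_le\<close>).  Only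
this inequality is needed: the separation condition then bounds every finite product of the numbers
\<open>sqrt (pseudohyp_sq (x j) (x k))\<close>, \<open>k \<noteq> j\<close>, from below by \<open>\<delta>\<close>, and hence every finite sum of
the numbers \<open>1 - pseudohyp_sq (x j) (x k)\<close> from above by \<open>L = 1 + 2 * ln (1 / \<delta>)\<close>.

The Beurling functions are built by the method of Jones and Berndtsson.  The function \<open>F j\<close> is a
product of three parts, each with value 1 at \<open>x j\<close>:

\<^item> the product over \<open>k \<noteq> j\<close> of \<open>moebius_inner (x k) (x j) z / pseudohyp_sq (x k) (x j)\<close>,
  which vanishes at \<open>x k\<close> for all \<open>k \<noteq> j\<close> and is bounded by \<open>1 / \<delta>\<close>
  (lemma \<open>norm_moebius_inner_le\<close>);

\<^item> the peak function \<open>(d (x j) / (1 - cinner z (x j))) ^ 4\<close>, of modulus \<open>peak (x j) z ^ 4\<close>;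

\<^item> the exponential of \<open>- 1 / L\<close> times the sum over \<open>k\<close> of
  \<open>damping (x k) (x j) z - damping (x k) (x j) (x j)\<close>, where the real part of \<open>damping\<close> is
  nonnegative and equals \<open>1 - pseudohyp_sq (x j) (x k)\<close> at \<open>x j\<close>, so that the normalisation costs
  a factor of at most \<open>exp 1\<close>.

A quasi-triangle inequality (lemma \<open>sine_sq_triangle\<close>) shows that
\<open>Re (damping (x k) (x j) z) \<ge> (peak (x k) z)\<^sup>2 * peak (x j) z / 4\<close> whenever
\<open>norm (x j) \<le> norm (x k)\<close> (lemma \<open>Re_damping_ge\<close>).  With \<open>A j\<close> the sum of
\<open>(peak (x k) z)\<^sup>2\<close> over these \<open>k\<close>, the modulus of \<open>F j z\<close> is therefore at most
\<open>exp 1 / \<delta> * peak (x j) z ^ 4 * exp (- peak (x j) z * A j / (4 * L))\<close>, which is at most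
\<open>4 * exp 1 / \<delta> * (peak (x j) z)\<^sup>2 / (1 + A j / (4 * L))\<^sup>2\<close>.  Arranged by decreasing norm of
\<open>x j\<close>, these bounds are terms of a Riemann sum for a convergent integral
(lemma \<open>sum_ordered_le\<close>), and the total is at most \<open>16 * exp 1 * L / \<delta>\<close>; since
\<open>(exp 1)\<^sup>2 \<le> 8\<close>, this is below the stated constant.  The series \<open>\<Sum>j. a j * F j\<close>
interpolates a bounded sequence \<open>a\<close>.

The infinite products and series are holomorphic because locally uniform limits of complex
Frechet differentiable functions are again such (lemma \<open>cfrechet_locally_uniform_limit\<close>).
\<close>

section \<open>Complex inner products\<close>

lemma scaleC_minus_one: "(-1) *\<^sub>C x = - (x::'a::complex_vector)"
  using scaleR_scaleC[of "-1" x] by simp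

lemma cinner_minus_left: "cinner (- x) y = - cinner x y"
  using cinner_scaleC_left[of "-1" x y] by (simp add: scaleC_minus_one)

lemma cinner_diff_left: "cinner (x - y) z = cinner x z - cinner y z"
  using cinner_add_left[of x "- y" z] by (simp add: cinner_minus_left)

lemma cinner_add_right: "cinner x (y + z) = cinner x y + cinner x z"
  by (subst (1 2 3) cinner_commute) (simp add: cinner_add_left)

lemma cinner_diff_right: "cinner x (y - z) = cinner x y - cinner x z"
  by (subst (1 2 3) cinner_commute) (simp add: cinner_diff_left)

lemma cinner_scaleC_right: "cinner x (c *\<^sub>C y) = cnj c * cinner x y"
  by (subst (1 2) cinner_commute) (simp add: cinner_scaleC_left)

lemma cinner_zero_left: "cinner 0 x = 0"
  using cinner_add_left[of 0 0 x] by simp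

lemma cinner_scaleR_left: "cinner (r *\<^sub>R x) y = complex_of_real r * cinner x y"
  by (simp add: scaleR_scaleC cinner_scaleC_left)

lemmas cinner_expand =
  cinner_add_left cinner_add_right cinner_diff_left cinner_diff_right
  cinner_scaleC_left cinner_scaleC_right

lemma norm_cinner_commute: "cmod (cinner x y) = cmod (cinner y x)"
  by (subst cinner_commute) simp

lemma norm_cinner_le: "cmod (cinner x y) \<le> norm x * norm y"
proof (cases "y = 0")
  case True
  then show ?thesis
    using cinner_commute[of x y] by (simp add: cinner_zero_left)
next
  case False
  define n where "n = complex_of_real ((norm y)\<^sup>2)"
  have n: "cinner y y = n" "cnj n = n" by (simp_all add: n_def cinner_self)
  define w where "w = n *\<^sub>C x - cinner x y *\<^sub>C y"
  have "cinner w w = n * (n * cinner x x - cinner x y * cnj (cinner x y))"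
    using cinner_commute[of y x] unfolding w_def
    by (simp add: cinner_expand n algebra_simps)
  then have "complex_of_real ((norm w)\<^sup>2)
      = complex_of_real ((norm y)\<^sup>2 * ((norm y)\<^sup>2 * (norm x)\<^sup>2 - (cmod (cinner x y))\<^sup>2))"
    by (simp only: cinner_self n_def complex_norm_square[symmetric] of_real_mult of_real_diff)
  then have "(norm w)\<^sup>2 = (norm y)\<^sup>2 * ((norm y)\<^sup>2 * (norm x)\<^sup>2 - (cmod (cinner x y))\<^sup>2)"
    using of_real_eq_iff by blast
  then have "0 \<le> (norm y)\<^sup>2 * ((norm y)\<^sup>2 * (norm x)\<^sup>2 - (cmod (cinner x y))\<^sup>2)"
    by (metis zero_le_power2)
  then have "(cmod (cinner x y))\<^sup>2 \<le> (norm y)\<^sup>2 * (norm x)\<^sup>2"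
    using False by (simp add: zero_le_mult_iff)
  then have "(cmod (cinner x y))\<^sup>2 \<le> (norm x * norm y)\<^sup>2"
    by (simp add: power_mult_distrib mult.commute)
  then show ?thesis by (rule power2_le_imp_le) simp
qed

lemma norm_scaleC: "norm (c *\<^sub>C x) = cmod c * norm (x::'a::complex_inner)"
proof -
  have "complex_of_real ((norm (c *\<^sub>C x))\<^sup>2) = c * cnj c * cinner x x"
    unfolding cinner_self[symmetric] by (simp add: cinner_expand)
  also have "\<dots> = complex_of_real ((cmod c * norm x)\<^sup>2)"
    by (simp only: cinner_self power_mult_distrib complex_norm_square of_real_mult)
  finally have "(norm (c *\<^sub>C x))\<^sup>2 = (cmod c * norm x)\<^sup>2"
    using of_real_eq_iff by blast
  then show ?thesis by (simp add: power2_eq_iff_nonneg)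
qed

lemma bounded_linear_cinner_left: "bounded_linear (\<lambda>z. cinner z a)"
  by (rule bounded_linear_intro[where K = "norm a"])
    (simp_all add: cinner_add_left cinner_scaleR_left scaleR_conv_of_real norm_cinner_le)

lemma bounded_linear_scaleC_left: "bounded_linear (\<lambda>c. c *\<^sub>C (v::'a::complex_inner))"
  by (rule bounded_linear_intro[where K = "norm v"])
    (simp_all add: scaleC_add_left scaleR_scaleC[where x = "_ *\<^sub>C v"] scaleC_scaleC norm_scaleC
      scaleR_conv_of_real)

lemma norm_cinner_less_1:
  assumes "norm x < 1" "norm y < 1"
  shows "cmod (cinner x y) < 1"
  using norm_cinner_le[of x y] mult_strict_mono'[OF assms] by simp

lemma norm_one_minus_cinner_ge:
  assumes "norm y < 1"
  shows "1 - norm x \<le> cmod (1 - cinner x y)"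
proof -
  have "cmod (cinner x y) \<le> norm x"
    using norm_cinner_le[of x y] assms mult_left_le[of "norm y" "norm x"] by simp
  then show ?thesis
    using norm_triangle_ineq2[of 1 "cinner x y"] by simp
qed

lemma one_minus_cinner_nonzero:
  assumes "norm x < 1" "norm y < 1"
  shows "1 - cinner x y \<noteq> 0"
  using norm_cinner_less_1[OF assms] by auto

section \<open>Holomorphic functions on an inner product space\<close>

lemma cfrechet_compose:
  assumes "cfrechet_differentiable_at f x" "(g has_field_derivative g') (at (f x))"
  shows "cfrechet_differentiable_at (\<lambda>z. g (f z)) x"
proof -
  obtain L where L: "(f has_derivative L) (at x)" "\<And>c h. L (c *\<^sub>C h) = c * L h"
    using assms(1) unfolding cfrechet_differentiable_at_def by blast
  have "((\<lambda>z. g (f z)) has_derivative (\<lambda>h. g' * L h)) (at x)"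
    using L(1) assms(2)[unfolded has_field_derivative_def] by (rule has_derivative_compose)
  then show ?thesis
    unfolding cfrechet_differentiable_at_def using L(2)
    by (intro exI[of _ "\<lambda>h. g' * L h"]) (auto simp: mult.left_commute)
qed

lemma cfrechet_cinner: "cfrechet_differentiable_at (\<lambda>z. cinner z a) x"
  unfolding cfrechet_differentiable_at_def
  using bounded_linear_imp_has_derivative[OF bounded_linear_cinner_left]
  by (intro exI[of _ "\<lambda>z. cinner z a"]) (auto simp: cinner_scaleC_left)

lemma cfrechet_const: "cfrechet_differentiable_at (\<lambda>z. c) x"
  unfolding cfrechet_differentiable_at_def
  by (intro exI[of _ "\<lambda>z. 0"]) auto

lemma cfrechet_mult:
  assumes "cfrechet_differentiable_at f x" "cfrechet_differentiable_at g x"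
  shows "cfrechet_differentiable_at (\<lambda>z. f z * g z) x"
proof -
  obtain L M where L: "(f has_derivative L) (at x)" "\<And>c h. L (c *\<^sub>C h) = c * L h"
    and M: "(g has_derivative M) (at x)" "\<And>c h. M (c *\<^sub>C h) = c * M h"
    using assms unfolding cfrechet_differentiable_at_def by blast
  show ?thesis
    unfolding cfrechet_differentiable_at_def
    using has_derivative_mult[OF L(1) M(1)] L(2) M(2)
    by (intro exI[of _ "\<lambda>h. f x * M h + L h * g x"]) (auto simp: algebra_simps)
qed

lemma cfrechet_add:
  assumes "cfrechet_differentiable_at f x" "cfrechet_differentiable_at g x"
  shows "cfrechet_differentiable_at (\<lambda>z. f z + g z) x"
proof -
  obtain L M where L: "(f has_derivative L) (at x)" "\<And>c h. L (c *\<^sub>C h) = c * L h"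
    and M: "(g has_derivative M) (at x)" "\<And>c h. M (c *\<^sub>C h) = c * M h"
    using assms unfolding cfrechet_differentiable_at_def by blast
  show ?thesis
    unfolding cfrechet_differentiable_at_def
    using has_derivative_add[OF L(1) M(1)] L(2) M(2)
    by (intro exI[of _ "\<lambda>h. L h + M h"]) (auto simp: algebra_simps)
qed

lemma cfrechet_diff:
  assumes "cfrechet_differentiable_at f x" "cfrechet_differentiable_at g x"
  shows "cfrechet_differentiable_at (\<lambda>z. f z - g z) x"
  using cfrechet_add[OF assms(1) cfrechet_mult[OF cfrechet_const[of "-1"] assms(2)]] by simp

lemma cfrechet_prod:
  assumes "\<And>k. k \<in> K \<Longrightarrow> cfrechet_differentiable_at (f k) x"
  shows "cfrechet_differentiable_at (\<lambda>z. \<Prod>k\<in>K. f k z) x"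
  using assms
  by (induction K rule: infinite_finite_induct) (auto intro: cfrechet_const cfrechet_mult)

lemma cfrechet_sum:
  assumes "\<And>k. k \<in> K \<Longrightarrow> cfrechet_differentiable_at (f k) x"
  shows "cfrechet_differentiable_at (\<lambda>z. \<Sum>k\<in>K. f k z) x"
  using assms
  by (induction K rule: infinite_finite_induct) (auto intro: cfrechet_const cfrechet_add)

lemma has_field_derivative_along_line:
  fixes f :: "'a::complex_inner \<Rightarrow> complex"
  assumes "(f has_derivative L) (at (p + \<mu> *\<^sub>C v))" "\<And>c h. L (c *\<^sub>C h) = c * L h"
  shows "((\<lambda>\<mu>. f (p + \<mu> *\<^sub>C v)) has_field_derivative L v) (at \<mu>)"
proof -
  have "((\<lambda>\<mu>. p + \<mu> *\<^sub>C v) has_derivative (\<lambda>\<mu>. \<mu> *\<^sub>C v)) (at \<mu>)"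
    using has_derivative_add[OF has_derivative_const[of p]
        bounded_linear_imp_has_derivative[OF bounded_linear_scaleC_left[of v]]]
    by simp
  from has_derivative_compose[OF this assms(1)]
  have "((\<lambda>\<mu>. f (p + \<mu> *\<^sub>C v)) has_derivative (\<lambda>\<mu>. \<mu> * L v)) (at \<mu>)"
    by (simp add: assms(2))
  moreover have "(\<lambda>\<mu>. \<mu> * L v) = (*) (L v)"
    by (simp add: fun_eq_iff mult.commute)
  ultimately show ?thesis unfolding has_field_derivative_def by metis
qed

text \<open>Cauchy's estimate, obtained on the complex line through \<open>x\<close> in direction \<open>v\<close>.\<close>

lemma cfrechet_Cauchy_estimate:
  assumes hol: "\<And>y. y \<in> cball x r \<Longrightarrow> cfrechet_differentiable_at f y"
    and bound: "\<And>y. y \<in> cball x r \<Longrightarrow> cmod (f y) \<le> M"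
    and r: "0 < r"
    and L: "(f has_derivative L) (at x)" "\<And>c h. L (c *\<^sub>C h) = c * L h"
  shows "cmod (L v) \<le> M / r * norm v"
proof (cases "v = 0")
  case True
  have "L (0 *\<^sub>C 0) = 0" by (simp only: L(2)) simp
  moreover have "(0::complex) *\<^sub>C (0::'a) = 0"
    using norm_scaleC[of 0 "0::'a"] by simp
  ultimately show ?thesis using True by simp
next
  case False
  define \<psi> where "\<psi> = (\<lambda>\<mu>. f (x + \<mu> *\<^sub>C v))"
  define s where "s = r / norm v"
  have s: "s > 0" using r False by (simp add: s_def)
  have mem: "x + \<mu> *\<^sub>C v \<in> cball x r" if "\<mu> \<in> cball 0 s" for \<mu>
    using that False by (simp add: dist_norm norm_scaleC s_def field_simps)
  have diff: "\<psi> field_differentiable (at \<mu>)" if "\<mu> \<in> cball 0 s" for \<mu>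
    using hol[OF mem[OF that]] has_field_derivative_along_line
    unfolding cfrechet_differentiable_at_def \<psi>_def field_differentiable_def by blast
  have "(deriv ^^ 1) \<psi> 0 = L v"
  proof -
    have z: "0 *\<^sub>C v = 0"
      using norm_scaleC[of 0 v] by simp
    have "(\<psi> has_field_derivative L v) (at 0)"
      unfolding \<psi>_def by (rule has_field_derivative_along_line) (use L z in auto)
    then show ?thesis by (simp add: DERIV_imp_deriv)
  qed
  moreover have "cmod ((deriv ^^ 1) \<psi> 0) \<le> fact 1 * M / s ^ 1"
  proof (rule Cauchy_inequality)
    show "\<psi> holomorphic_on ball 0 s"
      by (auto simp: holomorphic_on_def intro!: field_differentiable_at_within diff)
    show "continuous_on (cball 0 s) \<psi>"
      by (auto intro!: continuous_at_imp_continuous_on field_differentiable_imp_continuous_at diff)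
    show "cmod (\<psi> \<mu>) \<le> M" if "cmod (0 - \<mu>) = s" for \<mu>
      using bound[OF mem[of \<mu>]] that by (simp add: \<psi>_def)
  qed (rule s)
  ultimately show ?thesis using False r by (simp add: s_def field_simps)
qed

text \<open>By Cauchy's estimate the derivatives converge uniformly as well, so the limit may be
  differentiated termwise.\<close>

lemma cfrechet_uniform_limit:
  fixes f :: "nat \<Rightarrow> 'a::complex_inner \<Rightarrow> complex"
  assumes R: "0 < R"
    and hol: "\<And>n y. y \<in> ball p R \<Longrightarrow> cfrechet_differentiable_at (f n) y"
    and lim: "uniform_limit (ball p R) f g sequentially"
  shows "cfrechet_differentiable_at g p"
proof -
  have "\<forall>n. \<forall>y\<in>ball p R. \<exists>L. (f n has_derivative L) (at y) \<and> (\<forall>c h. L (c *\<^sub>C h) = c * L h)"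
    using hol unfolding cfrechet_differentiable_at_def by blast
  then obtain f' where f': "\<And>n y. y \<in> ball p R \<Longrightarrow> (f n has_derivative f' n y) (at y)"
    and hom: "\<And>n y c h. y \<in> ball p R \<Longrightarrow> f' n y (c *\<^sub>C h) = c * f' n y h"
    by metis
  define S where "S = ball p (R / 2)"
  have sub: "cball y (R / 4) \<subseteq> ball p R" if "y \<in> S" for y
  proof
    fix u assume "u \<in> cball y (R / 4)"
    then show "u \<in> ball p R"
      using that R dist_triangle[of p u y] by (simp add: S_def)
  qed
  have S_sub: "S \<subseteq> ball p R" using R by (auto simp: S_def)
  have Cauchy: "\<exists>N. \<forall>m\<ge>N. \<forall>n\<ge>N. \<forall>y\<in>S. \<forall>h. cmod (f' m y h - f' n y h) \<le> e * norm h"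
    if e: "e > 0" for e
  proof -
    have "e * R / 8 > 0" using e R by simp
    from uniform_limitD[OF lim this] obtain N
      where N: "\<And>n y. n \<ge> N \<Longrightarrow> y \<in> ball p R \<Longrightarrow> dist (f n y) (g y) < e * R / 8"
      unfolding eventually_sequentially by blast
    have "cmod (f' m y h - f' n y h) \<le> e * norm h"
      if "m \<ge> N" "n \<ge> N" "y \<in> S" for m n y h
    proof -
      have y: "y \<in> ball p R" using that S_sub by blast
      have "cmod (f' m y h - f' n y h) \<le> (e * R / 4) / (R / 4) * norm h"
      proof (rule cfrechet_Cauchy_estimate[where f = "\<lambda>y. f m y - f n y"
            and L = "\<lambda>h. f' m y h - f' n y h"])
        fix u assume "u \<in> cball y (R / 4)"
        then have u: "u \<in> ball p R" using sub that(3) by blast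
        show "cfrechet_differentiable_at (\<lambda>y. f m y - f n y) u"
          by (intro cfrechet_diff hol u)
        show "cmod (f m u - f n u) \<le> e * R / 4"
          using N[OF that(1) u] N[OF that(2) u] dist_triangle2[of "f m u" "f n u" "g u"]
          by (simp add: dist_norm)
      next
        show "((\<lambda>y. f m y - f n y) has_derivative (\<lambda>h. f' m y h - f' n y h)) (at y)"
          by (intro has_derivative_diff f' y)
        show "f' m y (c *\<^sub>C h) - f' n y (c *\<^sub>C h) = c * (f' m y h - f' n y h)" for c h
          by (simp add: hom[OF y] algebra_simps)
      qed (use R in simp)
      then show ?thesis using R by simp
    qed
    then show ?thesis by blast
  qed
  define g' where "g' y h = Lim sequentially (\<lambda>n. f' n y h)" for y h
  have lim': "(\<lambda>n. f' n y h) \<longlonglongrightarrow> g' y h" if y: "y \<in> S" for y h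
  proof -
    have "Cauchy (\<lambda>n. f' n y h)"
    proof (rule CauchyI)
      fix e :: real assume e: "e > 0"
      define e1 where "e1 = e / (norm h + 1)"
      have "norm h + 1 > 0" using norm_ge_zero[of h] by linarith
      then have e1: "e1 > 0" "e1 * norm h < e"
        using e by (simp_all add: e1_def pos_divide_less_eq)
      from Cauchy[OF e1(1)] obtain N
        where "\<And>m n. m \<ge> N \<Longrightarrow> n \<ge> N \<Longrightarrow> cmod (f' m y h - f' n y h) \<le> e1 * norm h"
        using y by blast
      then show "\<exists>M. \<forall>m\<ge>M. \<forall>n\<ge>M. cmod (f' m y h - f' n y h) < e"
        using e1(2) by (meson le_less_trans)
    qed
    then show ?thesis
      unfolding g'_def using Cauchy_convergent_iff convergent_LIMSEQ_iff by blast
  qed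
  have close: "\<forall>\<^sub>F n in sequentially. \<forall>y\<in>S. \<forall>h. cmod (f' n y h - g' y h) \<le> e * norm h"
    if e: "e > 0" for e
  proof -
    from Cauchy[OF e] obtain N where N: "\<And>m n y h. m \<ge> N \<Longrightarrow> n \<ge> N \<Longrightarrow> y \<in> S
        \<Longrightarrow> cmod (f' n y h - f' m y h) \<le> e * norm h" by blast
    have "cmod (f' n y h - g' y h) \<le> e * norm h" if "n \<ge> N" "y \<in> S" for n y h
    proof (rule tendsto_upperbound)
      show "(\<lambda>m. cmod (f' n y h - f' m y h)) \<longlonglongrightarrow> cmod (f' n y h - g' y h)"
        by (intro tendsto_intros lim' that)
      show "\<forall>\<^sub>F m in sequentially. cmod (f' n y h - f' m y h) \<le> e * norm h"
        using N that unfolding eventually_sequentially by blast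
    qed simp
    then show ?thesis unfolding eventually_sequentially by blast
  qed
  have p: "p \<in> S" using R by (simp add: S_def)
  have lim_g: "(\<lambda>n. f n y) \<longlonglongrightarrow> g y" if "y \<in> S" for y
    using tendsto_uniform_limitI[OF lim] S_sub that by blast
  have "\<exists>G. \<forall>y\<in>S. (\<lambda>n. f n y) \<longlonglongrightarrow> G y \<and> (G has_derivative g' y) (at y within S)"
  proof (rule has_derivative_sequence[where f' = f'])
    show "convex S" by (simp add: S_def)
    show "(f n has_derivative f' n y) (at y within S)" if "y \<in> S" for n y
      using f' S_sub that by (blast intro: has_derivative_at_withinI)
    show "\<forall>\<^sub>F n in sequentially. \<forall>y\<in>S. \<forall>h. cmod (f' n y h - g' y h) \<le> e * norm h"
      if "e > 0" for e by (rule close[OF that])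
    show "(\<lambda>n. f n p) \<longlonglongrightarrow> g p" by (rule lim_g[OF p])
  qed (rule p)
  then obtain G where G: "\<And>y. y \<in> S \<Longrightarrow> (\<lambda>n. f n y) \<longlonglongrightarrow> G y"
    "\<And>y. y \<in> S \<Longrightarrow> (G has_derivative g' y) (at y within S)" by blast
  have "(G has_derivative g' p) (at p)"
    using G(2)[OF p] p at_within_open[of p S] by (simp add: S_def)
  moreover have "G y = g y" if "y \<in> S" for y
    by (rule LIMSEQ_unique[OF G(1)[OF that] lim_g[OF that]])
  moreover have "open S" by (simp add: S_def)
  ultimately have "(g has_derivative g' p) (at p)"
    using p has_derivative_transform_within_open by blast
  moreover have "g' p (c *\<^sub>C h) = c * g' p h" for c h
  proof (rule LIMSEQ_unique[OF lim'[OF p]])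
    have "f' n p (c *\<^sub>C h) = c * f' n p h" for n
      using hom p S_sub by blast
    then show "(\<lambda>n. f' n p (c *\<^sub>C h)) \<longlonglongrightarrow> c * g' p h"
      using tendsto_mult_left[OF lim'[OF p]] by presburger
  qed
  ultimately show ?thesis unfolding cfrechet_differentiable_at_def by blast
qed

lemma cfrechet_locally_uniform_limit:
  fixes f :: "nat \<Rightarrow> 'a::complex_inner \<Rightarrow> complex"
  assumes hol: "\<And>n y. y \<in> ball 0 1 \<Longrightarrow> cfrechet_differentiable_at (f n) y"
    and lim: "\<And>r. 0 < r \<Longrightarrow> r < 1 \<Longrightarrow> uniform_limit (ball 0 r) f g sequentially"
    and p: "p \<in> ball 0 1"
  shows "cfrechet_differentiable_at g p"
proof -
  define R where "R = (1 - norm p) / 2"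
  have R: "0 < R" "norm p + R < 1" using p by (auto simp: R_def field_simps)
  have sub: "ball p R \<subseteq> ball 0 (norm p + R)"
  proof
    fix y assume "y \<in> ball p R"
    then show "y \<in> ball 0 (norm p + R)"
      using norm_triangle_sub[of y p] by (simp add: dist_norm norm_minus_commute)
  qed
  have "0 < norm p + R"
    using R(1) norm_ge_zero[of p] by linarith
  then have "uniform_limit (ball p R) f g sequentially"
    using uniform_limit_on_subset[OF lim sub] R(2) by blast
  moreover have "ball p R \<subseteq> ball 0 1" using sub R(2) by auto
  ultimately show ?thesis
    using cfrechet_uniform_limit[OF R(1)] hol by blast
qed

lemma norm_le_Hinf_norm:
  assumes "f \<in> Hinf" "z \<in> ball 0 1"
  shows "cmod (f z) \<le> Hinf_norm f"
proof -
  from assms(1) obtain B where "\<And>x. x \<in> ball 0 1 \<Longrightarrow> cmod (f x) \<le> B"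
    unfolding Hinf_def bounded_iff by blast
  then show ?thesis
    unfolding Hinf_norm_def using assms(2) by (intro cSUP_upper bdd_aboveI2) auto
qed

lemma Hinf_norm_le:
  fixes f :: "'a::complex_inner \<Rightarrow> complex"
  assumes "\<And>z. z \<in> ball 0 1 \<Longrightarrow> cmod (f z) \<le> B"
  shows "Hinf_norm f \<le> B"
  unfolding Hinf_norm_def using assms by (intro cSUP_least) auto

section \<open>The pseudohyperbolic distance\<close>

text \<open>For points of the unit ball the defect is comparable to the distance to the unit sphere.\<close>

definition defect :: "'a::real_normed_vector \<Rightarrow> real"
  where "defect x = 1 - (norm x)\<^sup>2"

text \<open>The closed expression for the square of the pseudohyperbolic distance.  Only the inequality
  between the two is proved below.\<close>

definition pseudohyp_sq :: "'a::complex_inner \<Rightarrow> 'a \<Rightarrow> real"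
  where "pseudohyp_sq x y = 1 - defect x * defect y / (cmod (1 - cinner x y))\<^sup>2"

lemma defect_pos: "norm x < 1 \<Longrightarrow> 0 < defect x"
  by (simp add: defect_def power_less_one_iff)

lemma defect_le_1: "defect x \<le> 1"
  by (simp add: defect_def)

lemma pseudohyp_Moebius: "pseudohyp z w = cmod (Moebius_function 0 z w)"
  unfolding pseudohyp_def Moebius_function_def by (simp add: norm_divide norm_minus_commute)

lemma Schwarz_Pick:
  assumes hol: "h holomorphic_on ball 0 1" and less: "\<And>z. cmod z < 1 \<Longrightarrow> cmod (h z) < 1"
    and z: "cmod z < 1" and w: "cmod w < 1"
  shows "pseudohyp (h z) (h w) \<le> pseudohyp z w"
proof -
  define \<phi> where "\<phi> = Moebius_function 0 (h z) \<circ> (h \<circ> Moebius_function 0 (- z))"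
  have z': "cmod (- z) < 1" using z by simp
  have M: "cmod (Moebius_function 0 (- z) u) < 1" if "cmod u < 1" for u
    using Moebius_function_norm_lt_1[OF z' that] .
  have "\<phi> holomorphic_on ball 0 1"
    unfolding \<phi>_def
  proof (intro holomorphic_on_compose_gen[where t = "ball 0 1"])
    show "Moebius_function 0 (- z) holomorphic_on ball 0 1"
      by (rule Moebius_function_holomorphic[OF z'])
    show "Moebius_function 0 (h z) holomorphic_on ball 0 1"
      by (rule Moebius_function_holomorphic[OF less[OF z]])
  qed (use hol M less in auto)
  moreover have "\<phi> 0 = 0"
    by (simp add: \<phi>_def Moebius_function_def)
  moreover have "cmod (\<phi> u) < 1" if "cmod u < 1" for u
    using Moebius_function_norm_lt_1[OF less[OF z] less[OF M[OF that]]] by (simp add: \<phi>_def)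
  moreover have "cmod (Moebius_function 0 z w) < 1"
    by (rule Moebius_function_norm_lt_1[OF z w])
  ultimately have "cmod (\<phi> (Moebius_function 0 z w)) \<le> cmod (Moebius_function 0 z w)"
    by (rule Schwarz_Lemma(1))
  moreover have "Moebius_function 0 (- z) (Moebius_function 0 z w) = w"
    by (rule Moebius_function_compose) (use z' w in auto)
  ultimately show ?thesis by (simp add: \<phi>_def pseudohyp_Moebius)
qed

lemma pseudohyp_square:
  assumes "1 - cnj z * w \<noteq> 0"
  shows "(pseudohyp z w)\<^sup>2
    = 1 - (1 - (cmod z)\<^sup>2) * (1 - (cmod w)\<^sup>2) / (cmod (1 - cnj z * w))\<^sup>2"
proof -
  have "(cmod (z - w))\<^sup>2 = (cmod (1 - cnj z * w))\<^sup>2 - (1 - (cmod z)\<^sup>2) * (1 - (cmod w)\<^sup>2)"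
    by (simp add: cmod_power2) (simp add: power2_eq_square algebra_simps)
  moreover have "(pseudohyp z w)\<^sup>2 = (cmod (z - w))\<^sup>2 / (cmod (1 - cnj z * w))\<^sup>2"
    by (simp only: pseudohyp_def norm_divide power_divide)
  ultimately show ?thesis
    using assms by (simp add: diff_divide_distrib)
qed

text \<open>The complex line through two points meets the ball in a disc.  With \<open>p\<close> the foot of
  the perpendicular from the origin and \<open>u\<close> a vector of the line whose length is the radius
  of the disc, the affine parametrisation by the unit disc carries the pseudohyperbolic distance of
  the disc to \<open>pseudohyp_sq\<close>.\<close>

lemma complex_line_disc:
  fixes x y :: "'a::complex_inner"
  assumes "norm x < 1" "norm y < 1" "x \<noteq> y"
  obtains p u \<mu> \<nu> where "x = p + \<mu> *\<^sub>C u" "y = p + \<nu> *\<^sub>C u" "cmod \<mu> < 1" "cmod \<nu> < 1"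
    "\<And>\<xi>. cmod \<xi> < 1 \<Longrightarrow> norm (p + \<xi> *\<^sub>C u) < 1"
    "pseudohyp_sq x y = (pseudohyp \<mu> \<nu>)\<^sup>2"
proof -
  define v where "v = y - x"
  define V where "V = (norm v)\<^sup>2"
  have V: "V > 0" "cinner v v = V" using assms(3) by (simp_all add: V_def v_def cinner_self)
  define c where "c = cinner x v / V"
  define p where "p = x - c *\<^sub>C v"
  define Q where "Q = 1 - (norm p)\<^sup>2"
  have perp: "cinner p v = 0" "cinner v p = 0"
  proof -
    show "cinner p v = 0" using V by (simp add: p_def cinner_expand c_def)
    then show "cinner v p = 0" by (subst cinner_commute) simp
  qed
  have expand: "cinner (p + \<mu> *\<^sub>C v) (p + \<nu> *\<^sub>C v) = (norm p)\<^sup>2 + \<mu> * cnj \<nu> * V" for \<mu> \<nu>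
    using perp V by (simp add: cinner_expand cinner_self)
  have x: "x = p + c *\<^sub>C v" by (simp add: p_def)
  have y: "y = p + (1 + c) *\<^sub>C v"
    by (simp add: p_def scaleC_add_left scaleC_one v_def)
  have "complex_of_real ((norm x)\<^sup>2) = (norm p)\<^sup>2 + c * cnj c * V"
    by (subst cinner_self[symmetric], subst (1 2) x, subst expand) simp
  also have "\<dots> = complex_of_real ((norm p)\<^sup>2 + (cmod c)\<^sup>2 * V)"
    by (simp add: complex_norm_square[symmetric] flip: of_real_mult of_real_add of_real_power)
  finally have "(norm x)\<^sup>2 = (norm p)\<^sup>2 + (cmod c)\<^sup>2 * V" using of_real_eq_iff by blast
  moreover have "(norm x)\<^sup>2 < 1" using assms(1) by (simp add: power_less_one_iff)
  moreover have "0 \<le> (cmod c)\<^sup>2 * V" using V by simp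
  ultimately have Q: "Q > 0" unfolding Q_def by linarith
  define R where "R = sqrt (Q / V)"
  have R: "R > 0" "R * R * V = Q" using Q V by (simp_all add: R_def)
  define u where "u = complex_of_real R *\<^sub>C v"
  have u: "(p + \<mu> *\<^sub>C u) = p + (\<mu> * R) *\<^sub>C v" for \<mu> by (simp add: u_def scaleC_scaleC)
  have inner: "1 - cinner (p + \<mu> *\<^sub>C u) (p + \<nu> *\<^sub>C u) = Q * (1 - \<mu> * cnj \<nu>)" for \<mu> \<nu>
  proof -
    have "\<mu> * R * cnj (\<nu> * R) * V = \<mu> * cnj \<nu> * of_real (R * R * V)" by simp
    then show ?thesis unfolding u expand R(2) by (simp add: Q_def algebra_simps)
  qed
  have defect: "defect (p + \<mu> *\<^sub>C u) = Q * (1 - (cmod \<mu>)\<^sup>2)" for \<mu>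
  proof -
    have "complex_of_real (defect (p + \<mu> *\<^sub>C u)) = 1 - cinner (p + \<mu> *\<^sub>C u) (p + \<mu> *\<^sub>C u)"
      by (simp add: defect_def cinner_self)
    also have "\<dots> = complex_of_real (Q * (1 - (cmod \<mu>)\<^sup>2))"
      unfolding inner by (simp add: complex_norm_square del: of_real_power)
    finally show ?thesis using of_real_eq_iff by blast
  qed
  define \<mu> \<nu> where "\<mu> = c / R" "\<nu> = (1 + c) / R"
  have xy: "x = p + \<mu> *\<^sub>C u" "y = p + \<nu> *\<^sub>C u"
    using R x y by (simp_all add: u \<mu>_\<nu>_def)
  have norms: "cmod \<xi> < 1 \<longleftrightarrow> norm (p + \<xi> *\<^sub>C u) < 1" for \<xi>
  proof -
    have "cmod \<xi> < 1 \<longleftrightarrow> 0 < Q * (1 - (cmod \<xi>)\<^sup>2)"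
      using Q by (simp add: zero_less_mult_iff power_less_one_iff)
    also have "\<dots> \<longleftrightarrow> norm (p + \<xi> *\<^sub>C u) < 1"
      by (simp add: defect[symmetric] defect_def power_less_one_iff)
    finally show ?thesis .
  qed
  have less: "cmod \<mu> < 1" "cmod \<nu> < 1"
    using norms assms xy by simp_all
  have "cmod (cnj \<mu> * \<nu>) < 1"
    using less mult_strict_mono'[of "cmod \<mu>" 1 "cmod \<nu>" 1] by (simp add: norm_mult)
  then have ne: "1 - cnj \<mu> * \<nu> \<noteq> 0" by auto
  have "cmod (1 - \<mu> * cnj \<nu>) = cmod (cnj (1 - cnj \<mu> * \<nu>))" by simp
  also have "\<dots> = cmod (1 - cnj \<mu> * \<nu>)" by (rule complex_mod_cnj)
  finally have "pseudohyp_sq x y = 1 - (Q * (1 - (cmod \<mu>)\<^sup>2)) * (Q * (1 - (cmod \<nu>)\<^sup>2))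
      / (Q * cmod (1 - cnj \<mu> * \<nu>))\<^sup>2"
    using Q unfolding pseudohyp_sq_def
    by (subst (1 2) xy(1), subst (1 2) xy(2))
      (simp only: defect inner norm_mult norm_of_real abs_of_pos)
  also have "\<dots> = (pseudohyp \<mu> \<nu>)\<^sup>2"
    unfolding pseudohyp_square[OF ne] using Q by (simp add: power2_eq_square)
  finally show ?thesis using that xy less norms by blast
qed

text \<open>The Schwarz--Pick lemma on the ball.\<close>

lemma pseudohyp_le_of_contractive:
  fixes f :: "'a::complex_inner \<Rightarrow> complex"
  assumes f: "\<And>z. z \<in> ball 0 1 \<Longrightarrow> cfrechet_differentiable_at f z"
      "\<And>z. z \<in> ball 0 1 \<Longrightarrow> cmod (f z) < 1"
    and xy: "norm x < 1" "norm y < 1"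
  shows "pseudohyp (f x) (f y) \<le> sqrt (pseudohyp_sq x y)"
proof (cases "x = y")
  case True
  have "cinner y y = complex_of_real ((norm y)\<^sup>2)" by (rule cinner_self)
  then have "1 - cinner y y = complex_of_real (defect y)"
    by (simp add: defect_def)
  then have "pseudohyp_sq y y = 0"
    using defect_pos[OF xy(2)] by (simp add: pseudohyp_sq_def power2_eq_square)
  then show ?thesis using True by (simp add: pseudohyp_def)
next
  case False
  obtain p u \<mu> \<nu> where eq: "x = p + \<mu> *\<^sub>C u" "y = p + \<nu> *\<^sub>C u" and less: "cmod \<mu> < 1" "cmod \<nu> < 1"
    and mem: "\<And>\<xi>. cmod \<xi> < 1 \<Longrightarrow> norm (p + \<xi> *\<^sub>C u) < 1"
    and sq: "pseudohyp_sq x y = (pseudohyp \<mu> \<nu>)\<^sup>2"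
    by (rule complex_line_disc[OF xy False]) (rule that; assumption)
  define h where "h = (\<lambda>\<xi>. f (p + \<xi> *\<^sub>C u))"
  have "h field_differentiable (at \<xi>)" if "cmod \<xi> < 1" for \<xi>
  proof -
    have "cfrechet_differentiable_at f (p + \<xi> *\<^sub>C u)"
      using f(1) mem[OF that] by simp
    then obtain L where L: "(f has_derivative L) (at (p + \<xi> *\<^sub>C u))"
      "\<And>c h. L (c *\<^sub>C h) = c * L h"
      unfolding cfrechet_differentiable_at_def by blast
    show ?thesis
      using has_field_derivative_along_line[OF L]
      unfolding h_def field_differentiable_def by blast
  qed
  then have "h holomorphic_on ball 0 1"
    by (auto simp: holomorphic_on_def intro: field_differentiable_at_within)
  moreover have "cmod (h \<xi>) < 1" if "cmod \<xi> < 1" for \<xi>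
    using f(2)[of "p + \<xi> *\<^sub>C u"] mem[OF that] by (simp add: h_def)
  ultimately have "pseudohyp (h \<mu>) (h \<nu>) \<le> pseudohyp \<mu> \<nu>"
    using less by (rule Schwarz_Pick)
  moreover have "pseudohyp \<mu> \<nu> = sqrt (pseudohyp_sq x y)"
    unfolding sq by (simp add: pseudohyp_def)
  moreover have "h \<mu> = f x" "h \<nu> = f y"
    unfolding h_def eq by (rule refl)+
  ultimately show ?thesis by simp
qed

text \<open>A function of norm 1 may attain modulus 1 in the ball; the previous lemma is therefore applied
  to \<open>t * f\<close> with \<open>t < 1\<close>.\<close>

lemma pseudohyp_le_of_Hinf_norm_le_1:
  fixes f :: "'a::complex_inner \<Rightarrow> complex"
  assumes f: "f \<in> Hinf" "Hinf_norm f \<le> 1" and xy: "norm x < 1" "norm y < 1"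
  shows "pseudohyp (f x) (f y) \<le> sqrt (pseudohyp_sq x y)"
proof -
  have le: "pseudohyp (of_real t * f x) (of_real t * f y) \<le> sqrt (pseudohyp_sq x y)"
    if t: "0 < t" "t < 1" for t
  proof (rule pseudohyp_le_of_contractive[where f = "\<lambda>z. of_real t * f z"])
    fix z :: 'a assume z: "z \<in> ball 0 1"
    show "cfrechet_differentiable_at (\<lambda>z. of_real t * f z) z"
      using f(1) z by (intro cfrechet_mult cfrechet_const) (auto simp: Hinf_def)
    have "cmod (f z) \<le> 1" using norm_le_Hinf_norm[OF f(1) z] f(2) by linarith
    then have "t * cmod (f z) \<le> t" using t mult_left_le[of "cmod (f z)" t] by simp
    moreover have "cmod (of_real t * f z) = t * cmod (f z)" using t by (simp add: norm_mult)
    ultimately show "cmod (of_real t * f z) < 1" using t by linarith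
  qed (use xy in auto)
  show ?thesis
  proof (cases "1 - cnj (f x) * f y = 0")
    case True
    \<comment> \<open>then the quotient defining the distance is \<open>0\<close> by convention\<close>
    have "0 \<le> pseudohyp (of_real (1/2) * f x) (of_real (1/2) * f y)"
      by (simp add: pseudohyp_def)
    also have "\<dots> \<le> sqrt (pseudohyp_sq x y)" by (rule le) auto
    finally show ?thesis using True by (simp add: pseudohyp_def)
  next
    case False
    show ?thesis
    proof (rule tendsto_upperbound)
      show "((\<lambda>t. pseudohyp (of_real t * f x) (of_real t * f y)) \<longlongrightarrow> pseudohyp (f x) (f y))
          (at_left (1::real))"
        unfolding pseudohyp_def using False by (auto intro!: tendsto_eq_intros)
      show "\<forall>\<^sub>F t in at_left 1. pseudohyp (of_real t * f x) (of_real t * f y)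
          \<le> sqrt (pseudohyp_sq x y)"
        unfolding eventually_at_left_field using le by (intro exI[of _ 0]) auto
    qed simp
  qed
qed

lemma rho_H_le:
  fixes x y :: "'a::complex_inner"
  assumes "norm x < 1" "norm y < 1"
  shows "rho_H x y \<le> sqrt (pseudohyp_sq x y)" and "0 \<le> rho_H x y"
proof -
  define \<F> where "\<F> = {f::'a \<Rightarrow> complex. f \<in> Hinf \<and> Hinf_norm f \<le> 1}"
  have zero: "(\<lambda>z. 0) \<in> \<F>"
    by (auto simp: \<F>_def Hinf_def cfrechet_const bounded_iff intro!: Hinf_norm_le)
  have le: "pseudohyp (f x) (f y) \<le> sqrt (pseudohyp_sq x y)" if "f \<in> \<F>" for f
    using pseudohyp_le_of_Hinf_norm_le_1 assms that by (auto simp: \<F>_def)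
  show "rho_H x y \<le> sqrt (pseudohyp_sq x y)"
    unfolding rho_H_def using zero le by (intro cSUP_least) (auto simp: \<F>_def)
  have "bdd_above ((\<lambda>f. pseudohyp (f x) (f y)) ` \<F>)"
    using le by (rule bdd_aboveI2)
  then have "pseudohyp 0 0 \<le> rho_H x y"
    unfolding rho_H_def \<F>_def[symmetric]
    using cSUP_upper[OF zero, of "\<lambda>f. pseudohyp (f x) (f y)"] by simp
  then show "0 \<le> rho_H x y" by (simp add: pseudohyp_def)
qed

section \<open>Consequences of the separation condition\<close>

lemma pseudohyp_sq_le_1: "norm x < 1 \<Longrightarrow> norm y < 1 \<Longrightarrow> pseudohyp_sq x y \<le> 1"
  using defect_pos[of x] defect_pos[of y] by (simp add: pseudohyp_sq_def)

lemma pseudohyp_sq_nonneg: "norm x < 1 \<Longrightarrow> norm y < 1 \<Longrightarrow> 0 \<le> pseudohyp_sq x y"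
  using rho_H_le[of x y] order_trans[of 0 "rho_H x y" "sqrt (pseudohyp_sq x y)"] by simp

lemma pseudohyp_sq_commute: "pseudohyp_sq x y = pseudohyp_sq y x"
proof -
  have "cmod (1 - cinner x y) = cmod (cnj (1 - cinner y x))"
    using cinner_commute[of x y] by simp
  also have "\<dots> = cmod (1 - cinner y x)" by (rule complex_mod_cnj)
  finally show ?thesis by (simp add: pseudohyp_sq_def mult.commute)
qed

lemma one_minus_cinner_self: "1 - cinner x x = complex_of_real (defect x)"
  by (simp add: cinner_self defect_def)

lemma pseudohyp_sq_self: "norm x < 1 \<Longrightarrow> pseudohyp_sq x x = 0"
  using defect_pos[of x]
  by (simp add: pseudohyp_sq_def one_minus_cinner_self power2_eq_square)

lemma separated_prod_ge:
  fixes x :: "nat \<Rightarrow> 'a::complex_inner"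
  assumes ball: "\<And>n. norm (x n) < 1" and sep: "uniformly_separated \<delta> x"
    and K: "finite K" "j \<notin> K"
  shows "\<delta> \<le> (\<Prod>k\<in>K. sqrt (pseudohyp_sq (x j) (x k)))"
proof -
  define f where "f k = (if k = j then 1 else rho_H (x j) (x k))" for k
  have f: "0 \<le> f k" "f k \<le> 1" for k
  proof -
    have "sqrt (pseudohyp_sq (x j) (x k)) \<le> 1"
      using pseudohyp_sq_le_1[OF ball ball] by simp
    then show "0 \<le> f k" "f k \<le> 1"
      using rho_H_le[OF ball[of j] ball[of k]] unfolding f_def by (simp_all, linarith)
  qed
  from sep have conv: "convergent_prod f" and ge: "\<delta> \<le> prodinf f"
    unfolding uniformly_separated_def f_def by auto
  have "decseq (\<lambda>n. \<Prod>i\<le>n. f i)"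
    by (rule decseq_SucI) (use f in \<open>auto intro!: mult_left_le prod_nonneg\<close>)
  from decseq_ge[OF this convergent_prod_LIMSEQ[OF conv]]
  have partial: "prodinf f \<le> (\<Prod>i\<le>n. f i)" for n .
  obtain n where n: "K \<subseteq> {..n}" using finite_nat_iff_bounded_le K(1) by auto
  have "(\<Prod>i\<le>n. f i) = prod f ({..n} - K) * prod f K"
    by (rule prod.subset_diff[OF n]) simp
  also have "\<dots> \<le> prod f K"
    using f by (intro mult_left_le_one_le prod_nonneg prod_le_1) auto
  also have "\<dots> \<le> (\<Prod>k\<in>K. sqrt (pseudohyp_sq (x j) (x k)))"
    using K(2) f rho_H_le[OF ball[of j] ball] by (intro prod_mono) (auto simp: f_def)
  finally show ?thesis using ge partial[of n] by linarith
qed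

lemma separated_pseudohyp_sq_ge:
  fixes x :: "nat \<Rightarrow> 'a::complex_inner"
  assumes "\<And>n. norm (x n) < 1" "uniformly_separated \<delta> x" "\<delta> > 0" "k \<noteq> j"
  shows "\<delta>\<^sup>2 \<le> pseudohyp_sq (x j) (x k)"
proof -
  have "\<delta> \<le> sqrt (pseudohyp_sq (x j) (x k))"
    using separated_prod_ge[of x \<delta> "{k}" j] assms by simp
  then show ?thesis
    using assms(3) pseudohyp_sq_nonneg[of "x j" "x k"] assms(1)
      power_mono[of \<delta> "sqrt (pseudohyp_sq (x j) (x k))" 2] by simp
qed

lemma separated_inj:
  fixes x :: "nat \<Rightarrow> 'a::complex_inner"
  assumes "\<And>n. norm (x n) < 1" "uniformly_separated \<delta> x" "\<delta> > 0" "x j = x k"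
  shows "j = k"
proof (rule ccontr)
  assume "j \<noteq> k"
  then have "\<delta>\<^sup>2 \<le> pseudohyp_sq (x j) (x k)"
    using separated_pseudohyp_sq_ge assms(1-3) by metis
  then show False using assms by (simp add: pseudohyp_sq_self)
qed

text \<open>The logarithm of the product bounds the terms with \<open>k \<noteq> j\<close>, by \<open>1 - t \<le> - ln t\<close>; the
  summand 1 is the term \<open>k = j\<close>.\<close>

lemma separated_sum_le:
  fixes x :: "nat \<Rightarrow> 'a::complex_inner"
  assumes ball: "\<And>n. norm (x n) < 1" and sep: "uniformly_separated \<delta> x" and \<delta>: "\<delta> > 0"
    and K: "finite K"
  shows "(\<Sum>k\<in>K. 1 - pseudohyp_sq (x j) (x k)) \<le> 1 + 2 * ln (1 / \<delta>)"
proof -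
  define K' where "K' = K - {j}"
  define q where "q k = pseudohyp_sq (x j) (x k)" for k
  have q: "0 \<le> q k" for k using pseudohyp_sq_nonneg[OF ball ball] by (simp add: q_def)
  have "\<delta> \<le> (\<Prod>k\<in>K'. sqrt (q k))"
    unfolding q_def by (rule separated_prod_ge[OF ball sep]) (use K in \<open>auto simp: K'_def\<close>)
  then have "\<delta>\<^sup>2 \<le> (\<Prod>k\<in>K'. sqrt (q k))\<^sup>2" using \<delta> by (intro power_mono) auto
  also have "\<dots> = (\<Prod>k\<in>K'. q k)"
    using q by (simp add: prod_power_distrib)
  also have "\<dots> \<le> (\<Prod>k\<in>K'. exp (- (1 - q k)))"
  proof (intro prod_mono conjI q)
    fix k show "q k \<le> exp (- (1 - q k))" using exp_ge_add_one_self[of "- (1 - q k)"] by simp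
  qed
  also have "\<dots> = exp (- (\<Sum>k\<in>K'. 1 - q k))"
    using K by (simp add: K'_def exp_sum sum_negf[symmetric])
  finally have "ln (\<delta>\<^sup>2) \<le> ln (exp (- (\<Sum>k\<in>K'. 1 - q k)))"
    using \<delta> by (intro ln_mono) auto
  then have "(\<Sum>k\<in>K'. 1 - q k) \<le> 2 * ln (1 / \<delta>)"
    using \<delta> by (simp add: ln_div ln_realpow)
  moreover have "(\<Sum>k\<in>K. 1 - q k) \<le> (\<Sum>k\<in>insert j K'. 1 - q k)"
    using K pseudohyp_sq_le_1[OF ball ball] by (intro sum_mono2) (auto simp: K'_def q_def)
  moreover have "(\<Sum>k\<in>insert j K'. 1 - q k) = 1 + (\<Sum>k\<in>K'. 1 - q k)"
    using K pseudohyp_sq_self[OF ball] by (subst sum.insert) (auto simp: K'_def q_def)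
  ultimately show ?thesis by (simp add: q_def)
qed

text \<open>A consequence of \<open>separated_sum_le\<close> for \<open>j = 0\<close>, because \<open>1 - pseudohyp_sq (x 0) (x k)\<close>
  is at least \<open>defect (x 0) * defect (x k) / 4\<close>.\<close>

lemma separated_summable_defect:
  fixes x :: "nat \<Rightarrow> 'a::complex_inner"
  assumes ball: "\<And>n. norm (x n) < 1" and sep: "uniformly_separated \<delta> x" and \<delta>: "\<delta> > 0"
  shows "summable (\<lambda>n. defect (x n))"
proof (rule summableI_nonneg_bounded)
  define d where "d = defect (x 0)"
  have d: "d > 0" using defect_pos[OF ball] by (simp add: d_def)
  show "0 \<le> defect (x n)" for n using defect_pos[OF ball] by (simp add: less_imp_le)
  have *: "d * defect (x k) / 4 \<le> 1 - pseudohyp_sq (x 0) (x k)" for k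
  proof -
    have "cmod (1 - cinner (x 0) (x k)) \<le> 2"
      using norm_triangle_ineq4[of 1 "cinner (x 0) (x k)"] norm_cinner_less_1[OF ball ball, of 0 k]
      by simp
    then have "(cmod (1 - cinner (x 0) (x k)))\<^sup>2 \<le> 2\<^sup>2" by (intro power_mono) auto
    then have "(cmod (1 - cinner (x 0) (x k)))\<^sup>2 \<le> 4" by simp
    moreover have "0 < (cmod (1 - cinner (x 0) (x k)))\<^sup>2"
      using one_minus_cinner_nonzero[OF ball ball] by simp
    moreover have "0 \<le> d * defect (x k)" using d defect_pos[OF ball, of k] by simp
    ultimately have "d * defect (x k) / 4
        \<le> d * defect (x k) / (cmod (1 - cinner (x 0) (x k)))\<^sup>2"
      by (intro divide_left_mono) auto
    then show ?thesis by (simp add: pseudohyp_sq_def d_def)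
  qed
  fix n
  have "d / 4 * (\<Sum>k<n. defect (x k)) = (\<Sum>k<n. d * defect (x k) / 4)"
    by (simp add: sum_distrib_left)
  also have "\<dots> \<le> (\<Sum>k<n. 1 - pseudohyp_sq (x 0) (x k))" by (intro sum_mono *)
  also have "\<dots> \<le> 1 + 2 * ln (1 / \<delta>)" by (rule separated_sum_le[OF ball sep \<delta>]) simp
  finally show "(\<Sum>k<n. defect (x k)) \<le> (1 + 2 * ln (1 / \<delta>)) * 4 / d"
    using d by (simp add: field_simps)
qed

section \<open>Building blocks\<close>

text \<open>If \<open>\<phi>\<^sub>a\<close> is the involutive automorphism of the ball exchanging \<open>0\<close> and \<open>a\<close>, then
  \<open>moebius_inner a b z\<close> is the inner product of \<open>\<phi>\<^sub>a z\<close> and \<open>\<phi>\<^sub>a b\<close>.  As a function of \<open>z\<close> it is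
  holomorphic, vanishes at \<open>a\<close>, and has the value \<open>pseudohyp_sq a b\<close> at \<open>b\<close>.\<close>

definition moebius_inner :: "'a::complex_inner \<Rightarrow> 'a \<Rightarrow> 'a \<Rightarrow> complex"
  where "moebius_inner a b z =
    1 - defect a * (1 - cinner z b) / ((1 - cinner z a) * (1 - cinner a b))"

lemma moebius_inner_zero:
  assumes "norm a < 1" "norm b < 1"
  shows "moebius_inner a b a = 0"
  using one_minus_cinner_nonzero[OF assms] defect_pos[OF assms(1)]
  by (simp add: moebius_inner_def one_minus_cinner_self)

lemma moebius_inner_self:
  "moebius_inner a b b = pseudohyp_sq a b"
proof -
  have "(1 - cinner b a) * (1 - cinner a b) = (1 - cinner a b) * cnj (1 - cinner a b)"
    using cinner_commute[of b a] by simp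
  also have "\<dots> = complex_of_real ((cmod (1 - cinner a b))\<^sup>2)"
    by (rule complex_norm_square[symmetric])
  finally show ?thesis
    unfolding moebius_inner_def pseudohyp_sq_def one_minus_cinner_self by simp
qed

text \<open>The vector \<open>u y\<close> in the proof is \<open>- (1 - cinner y a) *\<^sub>C \<phi>\<^sub>a y\<close>, and the norm of
  \<open>\<phi>\<^sub>a b\<close> is \<open>sqrt (pseudohyp_sq a b)\<close>, so the estimate is the Cauchy--Schwarz inequality.  The
  component of \<open>y\<close> along \<open>a\<close> in the usual formula for \<open>\<phi>\<^sub>a\<close> is written with the coefficient
  \<open>\<kappa> = 1 / (1 + s)\<close>, which avoids dividing by \<open>norm a\<close>.\<close>

lemma norm_moebius_inner_le:
  fixes a b z :: "'a::complex_inner"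
  assumes a: "norm a < 1" and b: "norm b < 1" and z: "norm z < 1"
  shows "cmod (moebius_inner a b z) \<le> sqrt (pseudohyp_sq a b)"
proof -
  define s where "s = sqrt (defect a)"
  define \<sigma> where "\<sigma> = complex_of_real s"
  have s: "s > 0" "s\<^sup>2 = defect a" using defect_pos[OF a] by (simp_all add: s_def)
  define \<kappa> where "\<kappa> = complex_of_real (1 / (1 + s))"
  have \<sigma>2: "\<sigma> * \<sigma> = defect a"
    unfolding \<sigma>_def by (simp flip: s(2) of_real_mult add: power2_eq_square)
  have aa: "cinner a a = 1 - \<sigma> * \<sigma>"
    unfolding \<sigma>2 by (simp add: one_minus_cinner_self[symmetric])
  have "1 + s \<noteq> 0" using s by linarith
  then have "complex_of_real (1 / (1 + s) * (1 + s)) = 1" by simp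
  then have \<kappa>: "\<kappa> * (1 + \<sigma>) = 1" by (simp only: \<kappa>_def \<sigma>_def of_real_mult of_real_add of_real_1)
  have \<kappa>n: "\<kappa> * cinner a a = 1 - \<sigma>"
  proof -
    have "\<kappa> * cinner a a = (\<kappa> * (1 + \<sigma>)) * (1 - \<sigma>)" unfolding aa by (simp add: algebra_simps)
    then show ?thesis using \<kappa> by simp
  qed
  have real: "cnj \<sigma> = \<sigma>" "cnj \<kappa> = \<kappa>" by (simp_all add: \<sigma>_def \<kappa>_def)
  define u where "u y = \<sigma> *\<^sub>C y - a + (\<kappa> * cinner y a) *\<^sub>C a" for y
  have u: "cinner (u y) (u w) = (1 - cinner y a) * (1 - cinner a w) - defect a * (1 - cinner y w)"
    for y w
  proof -
    have "cinner (u y) (u w) = \<sigma> * \<sigma> * cinner y w + cinner a a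
        - (\<sigma> + \<kappa> * cinner a a) * (cinner y a + cinner a w)
        + (2 * (\<kappa> * \<sigma>) + \<kappa> * (\<kappa> * cinner a a)) * (cinner y a * cinner a w)"
      using cinner_commute[of a w]
      by (simp add: u_def cinner_expand real algebra_simps)
    also have "2 * (\<kappa> * \<sigma>) + \<kappa> * (\<kappa> * cinner a a) = \<kappa> * (1 + \<sigma>)"
      unfolding \<kappa>n by (simp add: algebra_simps)
    also have "\<sigma> + \<kappa> * cinner a a = 1" unfolding \<kappa>n by simp
    finally show ?thesis
      unfolding \<kappa> aa by (simp add: algebra_simps \<sigma>2[symmetric])
  qed
  have norm_u: "(norm (u y))\<^sup>2 = (cmod (1 - cinner y a))\<^sup>2 - defect a * defect y" for y
  proof -
    have "complex_of_real ((norm (u y))\<^sup>2)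
        = (1 - cinner y a) * cnj (1 - cinner y a) - defect a * (1 - cinner y y)"
      using cinner_commute[of a y] u[of y y] by (simp add: cinner_self)
    also have "\<dots> = complex_of_real ((cmod (1 - cinner y a))\<^sup>2 - defect a * defect y)"
      by (simp only: complex_norm_square[symmetric] one_minus_cinner_self of_real_diff of_real_mult)
    finally show ?thesis using of_real_eq_iff by blast
  qed
  have nz: "1 - cinner z a \<noteq> 0" "1 - cinner a b \<noteq> 0"
    using one_minus_cinner_nonzero a b z by blast+
  have "(norm (u z))\<^sup>2 \<le> (cmod (1 - cinner z a))\<^sup>2"
    using defect_pos[OF a] defect_pos[OF z] by (simp add: norm_u)
  then have uz: "norm (u z) \<le> cmod (1 - cinner z a)" by (rule power2_le_imp_le) simp
  have comm: "cmod (1 - cinner b a) = cmod (1 - cinner a b)"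
    using complex_mod_cnj[of "1 - cinner b a"] cinner_commute[of a b] by simp
  have "(norm (u b))\<^sup>2 = (cmod (1 - cinner a b))\<^sup>2 * pseudohyp_sq a b"
    using nz by (simp add: norm_u comm pseudohyp_sq_def field_simps)
  then have ub: "norm (u b) = cmod (1 - cinner a b) * sqrt (pseudohyp_sq a b)"
    by (metis abs_norm_cancel real_sqrt_abs real_sqrt_mult)
  have "moebius_inner a b z = cinner (u z) (u b) / ((1 - cinner z a) * (1 - cinner a b))"
    unfolding moebius_inner_def u using nz by (simp add: diff_divide_distrib)
  then have "cmod (moebius_inner a b z)
      = cmod (cinner (u z) (u b)) / (cmod (1 - cinner z a) * cmod (1 - cinner a b))"
    by (simp only: norm_divide norm_mult)
  also have "\<dots> \<le> (cmod (1 - cinner z a) * (cmod (1 - cinner a b) * sqrt (pseudohyp_sq a b)))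
      / (cmod (1 - cinner z a) * cmod (1 - cinner a b))"
    using norm_cinner_le[of "u z" "u b"] uz unfolding ub
    by (intro divide_right_mono order_trans[OF norm_cinner_le] mult_mono)
      (auto simp: ub pseudohyp_sq_nonneg[OF a b])
  also have "\<dots> = sqrt (pseudohyp_sq a b)" using nz by simp
  finally show ?thesis .
qed

text \<open>For unit vectors \<open>sine_sq x y\<close> is the square of the sine of the angle between the complex
  lines spanned by them.\<close>

definition sine_sq :: "'a::complex_inner \<Rightarrow> 'a \<Rightarrow> real"
  where "sine_sq x y = 1 - (cmod (cinner x y))\<^sup>2"

lemma sine_sq_pos: "norm x < 1 \<Longrightarrow> norm y < 1 \<Longrightarrow> 0 < sine_sq x y"
  using norm_cinner_less_1[of x y] by (simp add: sine_sq_def power_less_one_iff)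

lemma sine_sq_commute: "sine_sq x y = sine_sq y x"
  by (simp add: sine_sq_def norm_cinner_commute[of x y])

lemma defect_le_sine_sq:
  assumes "norm x < 1" "norm y < 1"
  shows "defect y \<le> sine_sq x y"
proof -
  have "cmod (cinner x y) \<le> norm y"
    using norm_cinner_le[of x y] assms mult_right_le_one_le[of "norm y" "norm x"]
    by (simp add: mult.commute)
  then have "(cmod (cinner x y))\<^sup>2 \<le> (norm y)\<^sup>2" by (intro power_mono) auto
  then show ?thesis by (simp add: sine_sq_def defect_def)
qed

lemma sine_sq_le:
  assumes "norm x < 1" "norm y < 1"
  shows "sine_sq x y \<le> 2 * cmod (1 - cinner x y)"
proof -
  define t where "t = cmod (cinner x y)"
  have "1 - t \<le> cmod (1 - cinner x y)" using norm_triangle_ineq2[of 1 "cinner x y"] by (simp add: t_def)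
  moreover have "1 - t\<^sup>2 \<le> 2 * (1 - t)"
    using zero_le_power2[of "1 - t"] by (simp add: power2_eq_square algebra_simps)
  ultimately show ?thesis by (simp add: sine_sq_def t_def)
qed

text \<open>A quasi-triangle inequality.  The map \<open>p\<close> in the proof satisfies
  \<open>cinner (p c) (p d) = cinner c d - cinner c z * cinner z d\<close>; for a unit vector \<open>z\<close> it would be
  the orthogonal projection onto the complement of \<open>z\<close>.  For unit vectors the two cases are
  \<open>\<alpha> + \<beta> \<le> \<pi> / 2\<close> and \<open>\<alpha> + \<beta> > \<pi> / 2\<close> for the angles \<open>\<alpha>\<close>, \<open>\<beta>\<close> in the
  addition formula \<open>cos (\<alpha> + \<beta>) = cos \<alpha> * cos \<beta> - sin \<alpha> * sin \<beta>\<close>.\<close>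

lemma sine_sq_triangle:
  fixes a b z :: "'a::complex_inner"
  assumes a: "norm a < 1" and b: "norm b < 1" and z: "norm z < 1"
  shows "sine_sq a b \<le> 2 * sine_sq a z + 2 * sine_sq b z - defect a - defect b"
proof -
  define s where "s = sqrt (defect z)"
  have s: "s > 0" "s\<^sup>2 = defect z" using defect_pos[OF z] by (simp_all add: s_def)
  define k where "k = 1 / (1 + s)"
  define \<kappa> where "\<kappa> = complex_of_real k"
  have "2 * k - k * k * (1 - s\<^sup>2) = 1"
    using s(1) unfolding k_def by (simp add: divide_simps) (simp add: power2_eq_square algebra_simps)
  then have k: "2 * k - k * k * (norm z)\<^sup>2 = 1" using s(2) by (simp add: defect_def)
  have \<kappa>: "2 * \<kappa> - \<kappa> * \<kappa> * cinner z z = 1"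
    unfolding \<kappa>_def cinner_self using arg_cong[OF k, of complex_of_real]
    by (simp only: of_real_mult of_real_diff of_real_numeral of_real_1)
  define p where "p c = c - (\<kappa> * cinner c z) *\<^sub>C z" for c
  have p: "cinner (p c) (p d) = cinner c d - cinner c z * cinner z d" for c d
  proof -
    have "cinner (p c) (p d)
        = cinner c d - (2 * \<kappa> - \<kappa> * \<kappa> * cinner z z) * (cinner c z * cinner z d)"
      using cinner_commute[of z d]
      by (simp add: p_def cinner_expand \<kappa>_def algebra_simps)
    then show ?thesis by (simp add: \<kappa>)
  qed
  have norm_p: "(norm (p c))\<^sup>2 = (norm c)\<^sup>2 - (cmod (cinner c z))\<^sup>2" for c
  proof -
    have "complex_of_real ((norm (p c))\<^sup>2) = cinner c c - cinner c z * cnj (cinner c z)"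
      using p[of c c] cinner_commute[of z c] by (simp add: cinner_self)
    also have "\<dots> = complex_of_real ((norm c)\<^sup>2 - (cmod (cinner c z))\<^sup>2)"
      by (simp only: complex_norm_square[symmetric] cinner_self of_real_diff)
    finally show ?thesis using of_real_eq_iff by blast
  qed
  define A B X Y where "A = cmod (cinner a z)" and "B = cmod (cinner b z)"
    and "X = norm (p a)" and "Y = norm (p b)"
  have nonneg: "0 \<le> A" "0 \<le> B" "0 \<le> X" "0 \<le> Y" by (simp_all add: A_def B_def X_def Y_def)
  have less: "A < 1" "B < 1"
    using norm_cinner_less_1 a b z by (simp_all add: A_def B_def)
  have rhs: "2 * sine_sq a z + 2 * sine_sq b z - defect a - defect b
      = (1 - A\<^sup>2) + (1 - B\<^sup>2) + X\<^sup>2 + Y\<^sup>2"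
    using norm_p[of a] norm_p[of b] by (simp add: sine_sq_def defect_def A_def B_def X_def Y_def)
  have "X\<^sup>2 \<le> 1 - A\<^sup>2" "Y\<^sup>2 \<le> 1 - B\<^sup>2"
    using norm_p[of a] norm_p[of b] a b power_le_one[of "norm a" 2] power_le_one[of "norm b" 2]
    by (simp_all add: A_def B_def X_def Y_def)
  note XY = this
  have AB: "0 \<le> 1 - A\<^sup>2" "0 \<le> 1 - B\<^sup>2"
    using less nonneg by (simp_all add: power_le_one)
  have lower: "A * B - X * Y \<le> cmod (cinner a b)"
  proof -
    have "A * B = cmod (cinner a z * cinner z b)"
      using norm_cinner_commute[of b z] by (simp add: A_def B_def norm_mult)
    also have "\<dots> = cmod (cinner a b - cinner (p a) (p b))" by (simp add: p)
    also have "\<dots> \<le> cmod (cinner a b) + X * Y"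
      using norm_triangle_ineq4[of "cinner a b" "cinner (p a) (p b)"]
        norm_cinner_le[of "p a" "p b"] by (simp add: X_def Y_def)
    finally show ?thesis by simp
  qed
  show ?thesis
  proof (cases "X * Y \<le> A * B")
    case True
    then have "(A * B - X * Y)\<^sup>2 \<le> (cmod (cinner a b))\<^sup>2"
      using lower by (intro power_mono) auto
    then have "sine_sq a b \<le> 1 - (A * B - X * Y)\<^sup>2" by (simp add: sine_sq_def)
    also have "\<dots> = (1 - A\<^sup>2) + (1 - B\<^sup>2) - (1 - A\<^sup>2) * (1 - B\<^sup>2) + (A * B) * (2 * (X * Y)) - (X * Y)\<^sup>2"
      by (simp add: power2_eq_square algebra_simps)
    also have "\<dots> \<le> (1 - A\<^sup>2) + (1 - B\<^sup>2) + 2 * (X * Y)"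
    proof -
      have "(A * B) * (2 * (X * Y)) \<le> 2 * (X * Y)"
        using nonneg less by (intro mult_left_le_one_le mult_le_one) auto
      moreover have "0 \<le> (1 - A\<^sup>2) * (1 - B\<^sup>2)" using AB by simp
      ultimately show ?thesis using zero_le_power2[of "X * Y"] by linarith
    qed
    also have "\<dots> \<le> (1 - A\<^sup>2) + (1 - B\<^sup>2) + X\<^sup>2 + Y\<^sup>2"
      using sum_squares_bound[of X Y] by (simp add: mult.assoc)
    finally show ?thesis unfolding rhs .
  next
    case False
    then have "(A * B)\<^sup>2 \<le> (X * Y)\<^sup>2" using nonneg by (intro power_mono) auto
    also have "\<dots> \<le> (1 - A\<^sup>2) * (1 - B\<^sup>2)"
      unfolding power_mult_distrib using XY AB by (intro mult_mono) auto
    finally have "A\<^sup>2 + B\<^sup>2 \<le> 1" by (simp add: power_mult_distrib algebra_simps)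
    then have "1 \<le> (1 - A\<^sup>2) + (1 - B\<^sup>2) + X\<^sup>2 + Y\<^sup>2"
      using zero_le_power2[of X] zero_le_power2[of Y] by linarith
    moreover have "sine_sq a b \<le> 1" by (simp add: sine_sq_def)
    ultimately show ?thesis unfolding rhs by linarith
  qed
qed

text \<open>The function \<open>damping a b\<close> has nonnegative real part on the ball; its coefficient is chosen so
  that the real part at \<open>b\<close> equals \<open>1 - pseudohyp_sq b a\<close>.\<close>

definition damping :: "'a::complex_inner \<Rightarrow> 'a \<Rightarrow> 'a \<Rightarrow> complex"
  where "damping a b z = of_real (defect a * defect b / sine_sq a b)
    * ((1 + cinner z a) / (1 - cinner z a))"

text \<open>The modulus of the holomorphic function \<open>\<lambda>z. defect a / (1 - cinner z a)\<close>, which has the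
  value 1 at \<open>a\<close>.\<close>

definition peak :: "'a::complex_inner \<Rightarrow> 'a \<Rightarrow> real"
  where "peak a z = defect a / cmod (1 - cinner z a)"

lemma Re_Cayley: "Re ((1 + w) / (1 - w)) = (1 - (cmod w)\<^sup>2) / (cmod (1 - w))\<^sup>2"
proof -
  have "(1 + w) / (1 - w) = (1 + w) * cnj (1 - w) / complex_of_real ((cmod (1 - w))\<^sup>2)"
    by (metis complex_div_cnj of_real_power)
  then have "Re ((1 + w) / (1 - w)) = Re ((1 + w) * cnj (1 - w)) / (cmod (1 - w))\<^sup>2"
    by (simp only: Re_divide_of_real)
  also have "Re ((1 + w) * cnj (1 - w)) = 1 - (cmod w)\<^sup>2"
    unfolding cmod_power2 by (simp add: power2_eq_square algebra_simps)
  finally show ?thesis .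
qed

lemma Re_damping:
  "Re (damping a b z)
    = defect a * defect b / sine_sq a b * (sine_sq z a / (cmod (1 - cinner z a))\<^sup>2)"
  by (simp only: damping_def times_complex.sel Re_complex_of_real Im_complex_of_real
      mult_zero_left diff_zero Re_Cayley sine_sq_def)

lemma Re_damping_nonneg:
  assumes "norm a < 1" "norm b < 1" "norm z < 1"
  shows "0 \<le> Re (damping a b z)"
  unfolding Re_damping
  using sine_sq_pos[OF assms(3,1)] sine_sq_pos[OF assms(1,2)] defect_pos[OF assms(1)]
    defect_pos[OF assms(2)] by simp

lemma Re_damping_self:
  assumes "norm a < 1" "norm b < 1"
  shows "Re (damping a b b) = 1 - pseudohyp_sq b a"
  unfolding Re_damping pseudohyp_sq_def sine_sq_commute[of b a]
  using sine_sq_pos[OF assms] by simp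

text \<open>The condition on the norms enters through \<open>defect a \<le> defect b\<close>.  It is the reason for
  summing in the order of decreasing norm below.\<close>

lemma Re_damping_ge:
  assumes a: "norm a < 1" and b: "norm b < 1" and z: "norm z < 1" and le: "norm b \<le> norm a"
  shows "(peak a z)\<^sup>2 * peak b z / 4 \<le> Re (damping a b z)"
proof -
  define da db S sa sb where "da = defect a" and "db = defect b" and "S = sine_sq a b"
    and "sa = sine_sq z a" and "sb = sine_sq z b"
  define m n where "m = cmod (1 - cinner z a)" and "n = cmod (1 - cinner z b)"
  have pos: "0 < da" "0 < db" "0 < S" "0 < sa" "0 < sb" "0 < m" "0 < n"
    using defect_pos sine_sq_pos one_minus_cinner_nonzero a b z
    by (simp_all add: da_def db_def S_def sa_def sb_def m_def n_def)
  have "da \<le> db"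
    using le by (simp add: da_def db_def defect_def power_mono)
  moreover have "da \<le> sa" "db \<le> sb"
    using defect_le_sine_sq a b z by (simp_all add: da_def db_def sa_def sb_def)
  ultimately have "0 \<le> 2 * ((sa - da) * (sb - da)) + da * (db - da)"
    using pos by simp
  moreover have "da * S \<le> da * (2 * sa + 2 * sb - da - db)"
    using sine_sq_triangle[OF a b z] pos
    by (intro mult_left_mono)
      (simp_all add: S_def sa_def sb_def da_def db_def sine_sq_commute[of z])
  ultimately have "da * S \<le> 2 * (sa * sb)" by (simp add: algebra_simps)
  also have "\<dots> \<le> 4 * (sa * n)"
    using sine_sq_le[OF z b] pos by (simp add: sb_def n_def)
  finally have "da * S \<le> 4 * (sa * n)" .
  then have "da / (4 * n) \<le> sa / S"
    using pos by (simp add: field_simps)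
  have "(peak a z)\<^sup>2 * peak b z / 4 = (da * db / m\<^sup>2) * (da / (4 * n))"
    by (simp add: peak_def da_def db_def m_def n_def power2_eq_square mult_ac)
  also have "\<dots> \<le> (da * db / m\<^sup>2) * (sa / S)"
    using pos \<open>da / (4 * n) \<le> sa / S\<close> by (intro mult_left_mono) auto
  also have "\<dots> = Re (damping a b z)"
    by (simp add: Re_damping da_def db_def m_def sa_def S_def)
  finally show ?thesis .
qed

section \<open>The factors of the Beurling functions\<close>

text \<open>The factor belonging to the point \<open>a\<close> in the Beurling function of the point \<open>b\<close>, for
  points of the unit ball: it vanishes at \<open>a\<close> if \<open>a \<noteq> b\<close>, and takes the value 1 at \<open>b\<close>.  For \<open>a = b\<close> only the
  exponential remains.\<close>

definition beurling_factor :: "real \<Rightarrow> 'a::complex_inner \<Rightarrow> 'a \<Rightarrow> 'a \<Rightarrow> complex"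
  where "beurling_factor \<beta> b a z = (if a = b then 1 else moebius_inner a b z / pseudohyp_sq a b)
    * exp (- (of_real \<beta> * (damping a b z - damping a b b)))"

lemma beurling_factor_self:
  assumes "a = b \<or> 0 < pseudohyp_sq a b"
  shows "beurling_factor \<beta> b a b = 1"
  using assms by (auto simp: beurling_factor_def moebius_inner_self)

lemma beurling_factor_zero:
  assumes "norm a < 1" "norm b < 1" "a \<noteq> b"
  shows "beurling_factor \<beta> b a a = 0"
  using assms by (simp add: beurling_factor_def moebius_inner_zero)

lemma norm_beurling_factor_le:
  assumes a: "norm a < 1" and b: "norm b < 1" and z: "norm z < 1"
    and sep: "a = b \<or> 0 < pseudohyp_sq a b"
  shows "cmod (beurling_factor \<beta> b a z) \<le> (if a = b then 1 else 1 / sqrt (pseudohyp_sq a b))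
    * exp (\<beta> * (1 - pseudohyp_sq b a) - \<beta> * Re (damping a b z))"
proof -
  have "cmod (if a = b then 1 else moebius_inner a b z / pseudohyp_sq a b)
      \<le> (if a = b then 1 else 1 / sqrt (pseudohyp_sq a b))"
  proof (cases "a = b")
    case False
    then have pos: "0 < pseudohyp_sq a b" using sep by blast
    then have "cmod (moebius_inner a b z / pseudohyp_sq a b)
        \<le> sqrt (pseudohyp_sq a b) / pseudohyp_sq a b"
      using norm_moebius_inner_le[OF a b z] by (simp add: norm_divide divide_right_mono)
    also have "\<dots> = 1 / sqrt (pseudohyp_sq a b)" using pos by (simp add: real_div_sqrt field_simps)
    finally show ?thesis using False by simp
  qed simp
  moreover have "Re (- (of_real \<beta> * (damping a b z - damping a b b)))
      = \<beta> * (1 - pseudohyp_sq b a) - \<beta> * Re (damping a b z)"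
    by (simp add: Re_damping_self[OF a b] right_diff_distrib)
  ultimately show ?thesis
    unfolding beurling_factor_def norm_mult norm_exp_eq_Re
    by (metis exp_ge_zero mult_right_mono)
qed

lemma cfrechet_cinner_compose:
  assumes "g field_differentiable at (cinner z a)"
  shows "cfrechet_differentiable_at (\<lambda>z. g (cinner z a)) z"
  using assms unfolding field_differentiable_def by (auto intro: cfrechet_compose[OF cfrechet_cinner])

lemma cfrechet_inverse_one_minus_cinner:
  assumes "norm a < 1" "norm z < 1"
  shows "cfrechet_differentiable_at (\<lambda>z. 1 / (1 - cinner z a)) z"
  by (rule cfrechet_cinner_compose[where g = "\<lambda>w. 1 / (1 - w)"],
      intro field_differentiable_divide field_differentiable_diff field_differentiable_const
        field_differentiable_ident)
    (use one_minus_cinner_nonzero[OF assms(2,1)] in simp)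

lemma cfrechet_moebius_inner:
  assumes "norm a < 1" "norm z < 1"
  shows "cfrechet_differentiable_at (moebius_inner a b) z"
proof -
  have "cfrechet_differentiable_at (\<lambda>z. 1 - defect a / (1 - cinner a b)
      * ((1 - cinner z b) * (1 / (1 - cinner z a)))) z"
    by (intro cfrechet_diff cfrechet_mult cfrechet_const cfrechet_cinner
        cfrechet_inverse_one_minus_cinner assms)
  moreover have "(\<lambda>z. 1 - defect a / (1 - cinner a b)
      * ((1 - cinner z b) * (1 / (1 - cinner z a)))) = moebius_inner a b"
    by (simp add: fun_eq_iff moebius_inner_def mult.commute)
  ultimately show ?thesis by simp
qed

lemma cfrechet_damping:
  assumes "norm a < 1" "norm z < 1"
  shows "cfrechet_differentiable_at (damping a b) z"
proof -
  have "cfrechet_differentiable_at (\<lambda>z. of_real (defect a * defect b / sine_sq a b)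
      * ((1 + cinner z a) * (1 / (1 - cinner z a)))) z"
    by (intro cfrechet_add cfrechet_mult cfrechet_const cfrechet_cinner
        cfrechet_inverse_one_minus_cinner assms)
  moreover have "(\<lambda>z. of_real (defect a * defect b / sine_sq a b)
      * ((1 + cinner z a) * (1 / (1 - cinner z a)))) = damping a b"
    by (simp add: fun_eq_iff damping_def)
  ultimately show ?thesis by simp
qed

lemma cfrechet_beurling_factor:
  assumes a: "norm a < 1" and z: "norm z < 1"
  shows "cfrechet_differentiable_at (beurling_factor \<beta> b a) z"
proof -
  define G where "G z = (if a = b then 1 else 1 / pseudohyp_sq a b * moebius_inner a b z)" for z
  have G: "cfrechet_differentiable_at G z"
  proof (cases "a = b")
    case False
    then show ?thesis
      unfolding G_def by (simp only: if_False) (intro cfrechet_mult cfrechet_const cfrechet_moebius_inner a z)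
  next
    case True
    then show ?thesis unfolding G_def by (simp add: cfrechet_const)
  qed
  have "cfrechet_differentiable_at (\<lambda>z. exp (- \<beta> * (damping a b z - damping a b b))) z"
    by (rule cfrechet_compose[where g = exp and f = "\<lambda>z. - \<beta> * (damping a b z - damping a b b)"])
      (intro cfrechet_diff cfrechet_mult cfrechet_const cfrechet_damping a z, rule DERIV_exp)
  from cfrechet_mult[OF G this] show ?thesis
    by (simp add: G_def beurling_factor_def[abs_def] if_distrib cong: if_cong)
qed

lemma norm_one_minus_cinner_commute: "cmod (1 - cinner x y) = cmod (1 - cinner y x)"
  using complex_mod_cnj[of "1 - cinner x y"] cinner_commute[of y x] by simp

lemma norm_one_minus_cinner_le_2:
  assumes "norm x < 1" "norm y < 1"
  shows "cmod (1 - cinner x y) \<le> 2"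
  using norm_triangle_ineq4[of 1 "cinner x y"] norm_cinner_less_1[OF assms] by simp

lemma norm_damping_le:
  assumes a: "norm a < 1" and b: "norm b < 1" and z: "norm z < 1"
  shows "cmod (damping a b z) \<le> defect a * (2 / (1 - norm z))"
proof -
  have "0 \<le> defect a * defect b / sine_sq a b"
    using defect_pos[OF a] defect_pos[OF b] sine_sq_pos[OF a b] by simp
  moreover have "defect a * defect b / sine_sq a b \<le> defect a"
    using defect_le_sine_sq[OF a b] defect_pos[OF a] sine_sq_pos[OF a b]
    by (simp add: divide_le_eq)
  moreover have "cmod ((1 + cinner z a) / (1 - cinner z a)) \<le> 2 / (1 - norm z)"
    unfolding norm_divide
  proof (rule frac_le)
    show "cmod (1 + cinner z a) \<le> 2"
      using norm_triangle_ineq[of 1 "cinner z a"] norm_cinner_less_1[OF z a] by simp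
    show "1 - norm z \<le> cmod (1 - cinner z a)" by (rule norm_one_minus_cinner_ge[OF a])
  qed (use z in auto)
  ultimately show ?thesis
    unfolding damping_def norm_mult norm_of_real
    by (intro mult_mono) (use defect_pos[OF a] in auto)
qed

text \<open>Locally uniformly in \<open>z\<close>, the factors tend to 1 at a rate controlled by \<open>defect a\<close>.\<close>

lemma beurling_factor_near_1:
  fixes b :: "'a::complex_inner"
  assumes b: "norm b < 1" and r: "r < 1" and \<delta>: "0 < \<delta>" and \<beta>: "0 \<le> \<beta>"
  obtains C where "\<And>a z. norm a < 1 \<Longrightarrow> norm z \<le> r \<Longrightarrow> a = b \<or> \<delta>\<^sup>2 \<le> pseudohyp_sq a b
    \<Longrightarrow> cmod (beurling_factor \<beta> b a z - 1) \<le> C * defect a"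
proof
  define e s where "e = 1 - norm b" and "s = 1 - r"
  have e: "0 < e" "0 < s" using b r by (simp_all add: e_def s_def)
  define C1 where "C1 = (1 / e\<^sup>2 + 2 / (s * e)) / \<delta>\<^sup>2"
  define C2 where "C2 = \<beta> * (2 / s + 2 / e)"
  have C: "0 \<le> C1" "0 \<le> C2" using e \<delta> \<beta> by (simp_all add: C1_def C2_def)
  fix a z :: 'a assume a: "norm a < 1" and z: "norm z \<le> r" and sep: "a = b \<or> \<delta>\<^sup>2 \<le> pseudohyp_sq a b"
  have z1: "norm z < 1" using z r by linarith
  have d: "0 < defect a" "defect a \<le> 1" "0 < defect b" "defect b \<le> 1"
    using defect_pos a b defect_le_1 by blast+
  have ge: "e \<le> cmod (1 - cinner a b)" "s \<le> cmod (1 - cinner z a)"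
    using norm_one_minus_cinner_ge[OF a, of b] norm_one_minus_cinner_ge[OF a, of z] z
    by (simp_all add: e_def s_def norm_one_minus_cinner_commute[of a b])
  define G where "G = (if a = b then 1 else moebius_inner a b z / pseudohyp_sq a b)"
  have G: "cmod (G - 1) \<le> C1 * defect a"
  proof (cases "a = b")
    case True
    then show ?thesis using C d by (simp add: G_def)
  next
    case False
    define q where "q = pseudohyp_sq a b"
    have q: "\<delta>\<^sup>2 \<le> q" using sep False by (simp add: q_def)
    then have "0 < q" using zero_less_power[OF \<delta>, of 2] by linarith
    note q = q this
    define \<eta> where "\<eta> = defect a * (1 - cinner z b) / ((1 - cinner z a) * (1 - cinner a b))"
    have "1 - q = defect a * defect b / (cmod (1 - cinner a b))\<^sup>2" by (simp add: q_def pseudohyp_sq_def)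
    also have "\<dots> \<le> defect a * 1 / e\<^sup>2"
      using ge e d by (intro frac_le mult_left_mono power_mono) auto
    finally have q1: "1 - q \<le> defect a / e\<^sup>2" by simp
    have "0 \<le> 1 - q" using pseudohyp_sq_le_1[OF a b] by (simp add: q_def)
    note q1 = this q1
    have "cmod \<eta> = defect a * cmod (1 - cinner z b) / (cmod (1 - cinner z a) * cmod (1 - cinner a b))"
      using d by (simp only: \<eta>_def norm_divide norm_mult norm_of_real abs_of_pos)
    also have "\<dots> \<le> defect a * 2 / (s * e)"
      using ge e d norm_one_minus_cinner_le_2[OF z1 b]
      by (intro frac_le mult_left_mono mult_mono mult_pos_pos) auto
    finally have \<eta>: "cmod \<eta> \<le> defect a * (2 / (s * e))" by simp
    have "G - 1 = (of_real (1 - q) - \<eta>) / of_real q"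
      using False q(2) by (simp add: G_def moebius_inner_def q_def[symmetric] \<eta>_def field_simps)
    then have "cmod (G - 1) = cmod (of_real (1 - q) - \<eta>) / q"
      using q by (simp add: norm_divide)
    also have "\<dots> \<le> (defect a / e\<^sup>2 + defect a * (2 / (s * e))) / \<delta>\<^sup>2"
    proof (rule frac_le)
      have "cmod (of_real (1 - q) - \<eta>) \<le> cmod (of_real (1 - q)) + cmod \<eta>" by (rule norm_triangle_ineq4)
      also have "cmod (of_real (1 - q)) = 1 - q" using q1(1) by (simp only: norm_of_real abs_of_nonneg)
      finally show "cmod (of_real (1 - q) - \<eta>) \<le> defect a / e\<^sup>2 + defect a * (2 / (s * e))"
        using q1(2) \<eta> by linarith
    qed (use q \<delta> e d in auto)
    also have "\<dots> = C1 * defect a" by (simp add: C1_def field_simps)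
    finally show ?thesis .
  qed
  define v where "v = - (of_real \<beta> * (damping a b z - damping a b b))"
  have "cmod v = \<beta> * cmod (damping a b z - damping a b b)"
    using \<beta> by (simp add: v_def norm_mult)
  also have "\<dots> \<le> \<beta> * (defect a * (2 / s) + defect a * (2 / e))"
  proof (intro mult_left_mono \<beta>)
    have "2 / (1 - norm z) \<le> 2 / s" using z e by (intro frac_le) (auto simp: s_def)
    then have "defect a * (2 / (1 - norm z)) \<le> defect a * (2 / s)"
      using d by (intro mult_left_mono) auto
    then show "cmod (damping a b z - damping a b b) \<le> defect a * (2 / s) + defect a * (2 / e)"
      using norm_triangle_ineq4[of "damping a b z" "damping a b b"] norm_damping_le[OF a b z1]
        norm_damping_le[OF a b b] unfolding e_def by linarith
  qed
  finally have v: "cmod v \<le> C2 * defect a" by (simp add: C2_def algebra_simps)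
  have "C2 * defect a \<le> C2" using C d by (simp add: mult_left_le)
  then have "exp (cmod v) \<le> exp C2" using v by simp
  moreover have "cmod (exp v - 1) \<le> exp (cmod v) * cmod v"
    using Taylor_exp_field[of v 0] by simp
  ultimately have E: "cmod (exp v - 1) \<le> exp C2 * (C2 * defect a)"
    using v C by (meson exp_ge_zero mult_mono norm_ge_zero order_trans)
  have "C1 * defect a \<le> C1" using C d by (simp add: mult_left_le)
  then have "cmod G \<le> 1 + C1"
    using G norm_triangle_sub[of G 1] by simp
  then have "cmod (G * (exp v - 1)) \<le> (1 + C1) * (exp C2 * (C2 * defect a))"
    unfolding norm_mult using E C by (intro mult_mono) auto
  moreover have "beurling_factor \<beta> b a z - 1 = G * (exp v - 1) + (G - 1)"
    by (simp add: beurling_factor_def G_def v_def algebra_simps)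
  then have "cmod (beurling_factor \<beta> b a z - 1) \<le> cmod (G * (exp v - 1)) + cmod (G - 1)"
    by (simp only: norm_triangle_ineq)
  ultimately have "cmod (beurling_factor \<beta> b a z - 1)
      \<le> (1 + C1) * (exp C2 * (C2 * defect a)) + C1 * defect a"
    using G by linarith
  then show "cmod (beurling_factor \<beta> b a z - 1) \<le> ((1 + C1) * exp C2 * C2 + C1) * defect a"
    by (simp add: algebra_simps)
qed

lemma uniform_limit_summable_steps:
  fixes P :: "nat \<Rightarrow> 'a \<Rightarrow> complex"
  assumes step: "\<And>n z. z \<in> A \<Longrightarrow> cmod (P (Suc n) z - P n z) \<le> M n" and M: "summable M"
  shows "uniform_limit A P (\<lambda>z. lim (\<lambda>n. P n z)) sequentially"
proof -
  define S where "S z = P 0 z + (\<Sum>i. P (Suc i) z - P i z)" for z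
  have "uniform_limit A (\<lambda>n z. P 0 z + (\<Sum>i<n. P (Suc i) z - P i z)) S sequentially"
    unfolding S_def
    by (intro uniform_limit_add uniform_limit_const Weierstrass_m_test[OF _ M] step)
  moreover have "P 0 z + (\<Sum>i<n. P (Suc i) z - P i z) = P n z" for n z
    using sum_lessThan_telescope[of "\<lambda>n. P n z" n] by simp
  ultimately have S: "uniform_limit A P S sequentially" by simp
  have "S z = lim (\<lambda>n. P n z)" if "z \<in> A" for z
    using tendsto_uniform_limitI[OF S that] by (simp add: limI)
  then show ?thesis using uniform_limit_cong'[of A P P S "\<lambda>z. lim (\<lambda>n. P n z)"] S by simp
qed

lemma peak_nonneg: "norm a < 1 \<Longrightarrow> 0 \<le> peak a z"
  using defect_pos[of a] by (simp add: peak_def)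

lemma peak_le:
  assumes "norm a < 1" "norm z \<le> r" "r < 1"
  shows "peak a z \<le> defect a / (1 - r)"
  unfolding peak_def using norm_one_minus_cinner_ge[OF assms(1), of z] assms defect_pos[of a]
  by (intro divide_left_mono mult_pos_pos) auto

lemma peak_le_2:
  assumes a: "norm a < 1" and z: "norm z < 1"
  shows "peak a z \<le> 2"
proof -
  have "1 - norm a \<le> cmod (1 - cinner z a)"
    using norm_one_minus_cinner_ge[OF z, of a] norm_one_minus_cinner_commute[of z a] by simp
  then have "defect a / cmod (1 - cinner z a) \<le> defect a / (1 - norm a)"
    using a defect_pos[OF a] by (intro divide_left_mono mult_pos_pos) auto
  also have "\<dots> = 1 + norm a"
    using a by (simp add: defect_def field_simps power2_eq_square)
  finally show ?thesis using a by (simp add: peak_def)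
qed

section \<open>Summation in decreasing order\<close>

text \<open>A discrete form of \<open>\<integral> dt / (1 + c t)\<^sup>2 \<le> 1 / c\<close>: each term is bounded by
  the increment of \<open>t \<mapsto> - 1 / (c (1 + c t))\<close>.\<close>

lemma sum_ordered_le:
  fixes w key :: "'i \<Rightarrow> real"
  assumes fin: "finite J" and w: "\<And>j. j \<in> J \<Longrightarrow> 0 \<le> w j" and c: "0 < c"
  shows "(\<Sum>j\<in>J. w j / (1 + c * (\<Sum>k | k \<in> J \<and> key j \<le> key k. w k))\<^sup>2)
    \<le> (1 - 1 / (1 + c * sum w J)) / c"
  using fin w
proof (induction "card J" arbitrary: J)
  case 0
  then show ?case by simp
next
  case (Suc n)
  then have "J \<noteq> {}" by auto
  then obtain m where m: "m \<in> J" "\<And>j. j \<in> J \<Longrightarrow> key m \<le> key j"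
    using arg_min_if_finite[of J key] Suc.prems(1) by (metis not_le)
  define K where "K = J - {m}"
  have K: "finite K" "J = insert m K" "m \<notin> K" "card K = n" and wK: "\<And>k. k \<in> K \<Longrightarrow> 0 \<le> w k"
    using Suc m by (auto simp: K_def)
  define W where "W = sum w K"
  have W: "0 \<le> W" "0 \<le> w m" using wK Suc.prems(2) m by (auto simp: W_def intro: sum_nonneg)
  have J: "sum w J = w m + W" using K by (simp add: W_def)
  have "{k \<in> J. key m \<le> key k} = J" using m by auto
  then have "(\<Sum>j\<in>J. w j / (1 + c * (\<Sum>k | k \<in> J \<and> key j \<le> key k. w k))\<^sup>2)
      = w m / (1 + c * (w m + W))\<^sup>2
        + (\<Sum>j\<in>K. w j / (1 + c * (\<Sum>k | k \<in> J \<and> key j \<le> key k. w k))\<^sup>2)"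
    using K J by (metis (no_types, lifting) sum.insert)
  also have "(\<Sum>j\<in>K. w j / (1 + c * (\<Sum>k | k \<in> J \<and> key j \<le> key k. w k))\<^sup>2)
      \<le> (\<Sum>j\<in>K. w j / (1 + c * (\<Sum>k | k \<in> K \<and> key j \<le> key k. w k))\<^sup>2)"
  proof (rule sum_mono)
    \<comment> \<open>leaving out the element with the smallest key only decreases the inner sums\<close>
    fix j assume j: "j \<in> K"
    have "(\<Sum>k | k \<in> K \<and> key j \<le> key k. w k) \<le> (\<Sum>k | k \<in> J \<and> key j \<le> key k. w k)"
      using Suc.prems K by (intro sum_mono2) auto
    moreover have "0 \<le> (\<Sum>k | k \<in> K \<and> key j \<le> key k. w k)" using wK by (intro sum_nonneg) auto
    ultimately show "w j / (1 + c * (\<Sum>k | k \<in> J \<and> key j \<le> key k. w k))\<^sup>2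
        \<le> w j / (1 + c * (\<Sum>k | k \<in> K \<and> key j \<le> key k. w k))\<^sup>2"
      using c wK[OF j]
      by (intro divide_left_mono power_mono mult_pos_pos zero_less_power add_mono mult_left_mono)
        (auto intro: add_pos_nonneg)
  qed
  also have "\<dots> \<le> (1 - 1 / (1 + c * W)) / c"
    unfolding W_def using Suc.hyps(1)[of K] K wK by simp
  also have "w m / (1 + c * (w m + W))\<^sup>2 \<le> (1 / (1 + c * W) - 1 / (1 + c * (w m + W))) / c"
  proof -
    have p: "0 < 1 + c * W" "1 + c * W \<le> 1 + c * (w m + W)"
      using W c by (auto intro: add_pos_nonneg)
    have "w m / (1 + c * (w m + W))\<^sup>2 \<le> w m / ((1 + c * W) * (1 + c * (w m + W)))"
      unfolding power2_eq_square using p W by (intro divide_left_mono mult_right_mono mult_pos_pos) auto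
    also have "\<dots> = (1 / (1 + c * W) - 1 / (1 + c * (w m + W))) / c"
    proof -
      have ne: "1 + c * W \<noteq> 0" "1 + c * (w m + W) \<noteq> 0" using p by linarith+
      have "1 / (1 + c * W) - 1 / (1 + c * (w m + W))
          = (c * w m) / ((1 + c * W) * (1 + c * (w m + W)))"
        by (subst diff_frac_eq[OF ne]) (simp add: algebra_simps)
      then show ?thesis using c by simp
    qed
    finally show ?thesis .
  qed
  finally show ?case unfolding J by (simp add: diff_divide_distrib)
qed

text \<open>Two of the four powers of \<open>t\<close> absorb the factor \<open>t\<close> in the exponent.\<close>

lemma power_times_exp_le:
  fixes t A c :: real
  assumes "0 \<le> t" "t \<le> 2" "0 \<le> A" "0 < c"
  shows "t ^ 4 * exp (- (c * t * A)) \<le> 4 * (t\<^sup>2 / (1 + c * A)\<^sup>2)"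
proof -
  define y where "y = c * t * A / 2"
  have pos: "0 < 1 + c * A" using assms by (simp add: add_pos_nonneg)
  have "t * (1 + c * A) \<le> 2 * (1 + y)"
    using assms by (simp add: y_def algebra_simps)
  also have "\<dots> \<le> 2 * exp y" by (intro mult_left_mono exp_ge_add_one_self) simp
  finally have "t * exp (- y) \<le> 2 / (1 + c * A)"
    using pos by (simp add: exp_minus field_simps)
  then have "(t * exp (- y))\<^sup>2 \<le> (2 / (1 + c * A))\<^sup>2"
    using assms by (intro power_mono) auto
  moreover have "(exp (- y))\<^sup>2 = exp (- (c * t * A))"
    by (simp add: y_def flip: exp_double)
  ultimately have "t\<^sup>2 * exp (- (c * t * A)) \<le> 4 / (1 + c * A)\<^sup>2"
    by (simp add: power_mult_distrib power_divide)
  then have "t\<^sup>2 * (t\<^sup>2 * exp (- (c * t * A))) \<le> t\<^sup>2 * (4 / (1 + c * A)\<^sup>2)"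
    by (rule mult_left_mono) simp
  then show ?thesis by (simp add: power4_eq_xxxx power2_eq_square mult_ac)
qed

section \<open>Beurling functions of a separated sequence\<close>

locale separated_sequence =
  fixes x :: "nat \<Rightarrow> 'a::complex_inner" and \<delta> :: real
  assumes in_ball: "norm (x n) < 1"
    and separated: "uniformly_separated \<delta> x"
    and delta_pos: "0 < \<delta>"
begin

text \<open>\<open>L\<close> bounds \<open>\<Sum>k\<in>K. 1 - pseudohyp_sq (x j) (x k)\<close> for every finite
  \<open>K\<close> and every \<open>j\<close>.\<close>

definition L :: real
  where "L = 1 + 2 * ln (1 / \<delta>)"

text \<open>The infinite product defining the Beurling function of \<open>x j\<close>, cut off after \<open>N\<close> factors.
  The factor \<open>k = j\<close> is included; it consists of the exponential alone.\<close>

definition partial_beurling :: "nat \<Rightarrow> nat \<Rightarrow> 'a \<Rightarrow> complex"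
  where "partial_beurling j N z = (defect (x j) * (1 / (1 - cinner z (x j)))) ^ 4
    * (\<Prod>k<N. beurling_factor (1 / L) (x j) (x k) z)"

text \<open>The limit exists for \<open>z\<close> in the unit ball (lemma \<open>tendsto_beurling\<close>); elsewhere the value
  is irrelevant.\<close>

definition beurling :: "nat \<Rightarrow> 'a \<Rightarrow> complex"
  where "beurling j z = lim (\<lambda>N. partial_beurling j N z)"

lemma L_ge_1: "1 \<le> L"
proof -
  have "\<delta> \<le> 1" using separated_prod_ge[OF in_ball separated, of "{}"] by simp
  then have "0 \<le> ln (1 / \<delta>)" using delta_pos by (intro ln_ge_zero) simp
  then show ?thesis by (simp add: L_def)
qed

lemma inj_x: "x j = x k \<longleftrightarrow> j = k"
  using separated_inj[OF in_ball separated delta_pos] by blast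

lemma pseudohyp_sq_ge: "x k = x j \<or> \<delta>\<^sup>2 \<le> pseudohyp_sq (x k) (x j)"
  using separated_pseudohyp_sq_ge[OF in_ball separated delta_pos, of j k] by (auto simp: inj_x)

lemma pseudohyp_sq_pos: "x k = x j \<or> 0 < pseudohyp_sq (x k) (x j)"
  using pseudohyp_sq_ge[of k j] zero_less_power[OF delta_pos, of 2] by linarith

text \<open>The constant \<open>1 / \<delta>\<close> comes from dividing by \<open>pseudohyp_sq (x k) (x j)\<close>, and \<open>exp 1\<close> from
  subtracting the values of the damping terms at \<open>x j\<close>, whose real parts add up to at most
  \<open>L\<close>.\<close>

lemma norm_partial_beurling_le:
  assumes z: "norm z < 1"
  shows "cmod (partial_beurling j N z) \<le> peak (x j) z ^ 4 * (exp 1 / \<delta>)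
    * exp (- (\<Sum>k<N. Re (damping (x k) (x j) z)) / L)"
proof -
  define c where "c k = (if x k = x j then 1 else 1 / sqrt (pseudohyp_sq (x k) (x j)))" for k
  define E where "E k = 1 / L * (1 - pseudohyp_sq (x j) (x k)) - 1 / L * Re (damping (x k) (x j) z)" for k
  have c: "0 \<le> c k" for k using pseudohyp_sq_pos[of k j] by (auto simp: c_def)
  have "cmod (\<Prod>k<N. beurling_factor (1 / L) (x j) (x k) z) \<le> (\<Prod>k<N. c k * exp (E k))"
    unfolding prod_norm[symmetric] c_def E_def
    by (intro prod_mono conjI norm_ge_zero norm_beurling_factor_le in_ball z pseudohyp_sq_pos)
  also have "\<dots> = (\<Prod>k<N. c k) * exp (\<Sum>k<N. E k)"
    by (simp add: prod.distrib exp_sum)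
  also have "\<dots> \<le> (1 / \<delta>) * exp (1 - (\<Sum>k<N. Re (damping (x k) (x j) z)) / L)"
  proof (rule mult_mono)
    define P where "P = (\<Prod>k\<in>{..<N} - {j}. sqrt (pseudohyp_sq (x j) (x k)))"
    have P: "\<delta> \<le> P" unfolding P_def by (rule separated_prod_ge[OF in_ball separated]) auto
    have "(\<Prod>k<N. c k) = (\<Prod>k\<in>{..<N} - {j}. c k)"
      by (rule prod.mono_neutral_right) (auto simp: c_def)
    also have "\<dots> = (\<Prod>k\<in>{..<N} - {j}. 1 / sqrt (pseudohyp_sq (x j) (x k)))"
      by (rule prod.cong) (auto simp: c_def inj_x pseudohyp_sq_commute[of "x j"])
    also have "\<dots> = 1 / P" by (simp add: P_def prod_dividef)
    also have "\<dots> \<le> 1 / \<delta>" using P delta_pos by (intro divide_left_mono) auto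
    finally show "(\<Prod>k<N. c k) \<le> 1 / \<delta>" .
    have "(\<Sum>k<N. 1 - pseudohyp_sq (x j) (x k)) \<le> L"
      unfolding L_def by (rule separated_sum_le[OF in_ball separated delta_pos]) simp
    then have "(\<Sum>k<N. 1 - pseudohyp_sq (x j) (x k)) / L \<le> 1"
      using L_ge_1 by simp
    moreover have "(\<Sum>k<N. E k) = (\<Sum>k<N. 1 - pseudohyp_sq (x j) (x k)) / L
        - (\<Sum>k<N. Re (damping (x k) (x j) z)) / L"
      unfolding E_def by (simp only: sum_subtractf[symmetric] sum_divide_distrib) (simp add: diff_divide_distrib)
    ultimately show "exp (\<Sum>k<N. E k) \<le> exp (1 - (\<Sum>k<N. Re (damping (x k) (x j) z)) / L)"
      by simp
  qed (use delta_pos c in \<open>auto intro: prod_nonneg\<close>)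
  also have "\<dots> = (exp 1 / \<delta>) * exp (- (\<Sum>k<N. Re (damping (x k) (x j) z)) / L)"
    by (simp add: exp_diff exp_minus field_simps)
  finally have prod: "cmod (\<Prod>k<N. beurling_factor (1 / L) (x j) (x k) z)
    \<le> (exp 1 / \<delta>) * exp (- (\<Sum>k<N. Re (damping (x k) (x j) z)) / L)" .
  have "cmod ((defect (x j) * (1 / (1 - cinner z (x j)))) ^ 4) = peak (x j) z ^ 4"
    using defect_pos[OF in_ball, of j] by (simp add: peak_def norm_power norm_divide)
  then have "cmod (partial_beurling j N z)
      = peak (x j) z ^ 4 * cmod (\<Prod>k<N. beurling_factor (1 / L) (x j) (x k) z)"
    unfolding partial_beurling_def by (simp only: norm_mult)
  then show ?thesis
    unfolding mult.assoc using mult_left_mono[OF prod, of "peak (x j) z ^ 4"] peak_nonneg[OF in_ball]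
    by simp
qed

lemma norm_partial_beurling_le':
  assumes z: "norm z < 1"
  shows "cmod (partial_beurling j N z) \<le> peak (x j) z ^ 4 * (exp 1 / \<delta>)"
proof -
  have "0 \<le> (\<Sum>k<N. Re (damping (x k) (x j) z))"
    by (intro sum_nonneg Re_damping_nonneg in_ball z)
  then have "exp (- (\<Sum>k<N. Re (damping (x k) (x j) z)) / L) \<le> 1"
    using L_ge_1 by simp
  moreover have "0 \<le> peak (x j) z ^ 4 * (exp 1 / \<delta>)"
    using delta_pos peak_nonneg[OF in_ball] by simp
  ultimately show ?thesis
    using norm_partial_beurling_le[OF z, of j N] by (meson mult_left_le order_trans)
qed

lemma cfrechet_partial_beurling:
  assumes z: "norm z < 1"
  shows "cfrechet_differentiable_at (partial_beurling j N) z"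
proof -
  have "cfrechet_differentiable_at (\<lambda>z. defect (x j) * (1 / (1 - cinner z (x j)))) z"
    by (intro cfrechet_mult cfrechet_const cfrechet_inverse_one_minus_cinner in_ball z)
  from cfrechet_prod[of "{..<4::nat}", OF this]
  have "cfrechet_differentiable_at (\<lambda>z. (defect (x j) * (1 / (1 - cinner z (x j)))) ^ 4) z"
    by simp
  then show ?thesis
    unfolding partial_beurling_def[abs_def]
    by (intro cfrechet_mult cfrechet_prod cfrechet_beurling_factor in_ball z)
qed

lemma uniform_limit_beurling:
  assumes r: "r < 1"
  shows "uniform_limit (ball 0 r) (partial_beurling j) (beurling j) sequentially"
proof -
  obtain C where C: "\<And>a z. norm a < 1 \<Longrightarrow> norm z \<le> r
      \<Longrightarrow> a = x j \<or> \<delta>\<^sup>2 \<le> pseudohyp_sq a (x j)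
      \<Longrightarrow> cmod (beurling_factor (1 / L) (x j) a z - 1) \<le> C * defect a"
    by (rule beurling_factor_near_1[OF in_ball r delta_pos, of "1 / L" j]) (use L_ge_1 in auto)
  define B where "B = 2 ^ 4 * (exp 1 / \<delta>)"
  show ?thesis
    unfolding beurling_def[abs_def]
  proof (rule uniform_limit_summable_steps)
    fix n and z :: 'a assume "z \<in> ball 0 r"
    then have z: "norm z \<le> r" "norm z < 1" using r by auto
    have "peak (x j) z ^ 4 * (exp 1 / \<delta>) \<le> B"
      unfolding B_def using peak_le_2[OF in_ball z(2)] peak_nonneg[OF in_ball] delta_pos
      by (intro mult_right_mono power_mono) auto
    then have B: "cmod (partial_beurling j n z) \<le> B"
      using norm_partial_beurling_le'[OF z(2), of j n] by linarith
    have "partial_beurling j (Suc n) z - partial_beurling j n z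
        = partial_beurling j n z * (beurling_factor (1 / L) (x j) (x n) z - 1)"
      by (simp add: partial_beurling_def algebra_simps)
    also have "cmod \<dots> \<le> B * (C * defect (x n))"
      unfolding norm_mult using B C[OF in_ball z(1) pseudohyp_sq_ge]
      by (intro mult_mono) (auto intro: order_trans[OF norm_ge_zero])
    finally show "cmod (partial_beurling j (Suc n) z - partial_beurling j n z)
      \<le> B * (C * defect (x n))" .
  next
    show "summable (\<lambda>n. B * (C * defect (x n)))"
      by (intro summable_mult separated_summable_defect[OF in_ball separated delta_pos])
  qed
qed

lemma tendsto_beurling:
  assumes z: "norm z < 1"
  shows "(\<lambda>N. partial_beurling j N z) \<longlonglongrightarrow> beurling j z"
proof -
  obtain r where "norm z < r" "r < 1" using dense[OF z] by blast
  then show ?thesis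
    using tendsto_uniform_limitI[OF uniform_limit_beurling[of r j], of z] by simp
qed

lemma norm_beurling_le':
  assumes z: "norm z < 1"
  shows "cmod (beurling j z) \<le> peak (x j) z ^ 4 * (exp 1 / \<delta>)"
  by (rule tendsto_upperbound[OF tendsto_norm[OF tendsto_beurling[OF z]]])
    (intro always_eventually allI norm_partial_beurling_le' z, simp)

text \<open>The sum may be restricted to any finite set because the omitted terms are nonnegative.\<close>

lemma norm_beurling_le:
  assumes z: "norm z < 1" and J: "finite J"
  shows "cmod (beurling j z) \<le> peak (x j) z ^ 4 * (exp 1 / \<delta>)
    * exp (- (\<Sum>k\<in>J. Re (damping (x k) (x j) z)) / L)"
proof (rule tendsto_upperbound[OF tendsto_norm[OF tendsto_beurling[OF z]]])
  obtain n where n: "J \<subseteq> {..<n}" using finite_nat_bounded[OF J] by blast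
  have "cmod (partial_beurling j N z) \<le> peak (x j) z ^ 4 * (exp 1 / \<delta>)
    * exp (- (\<Sum>k\<in>J. Re (damping (x k) (x j) z)) / L)" if "n \<le> N" for N
  proof -
    have "(\<Sum>k\<in>J. Re (damping (x k) (x j) z)) \<le> (\<Sum>k<N. Re (damping (x k) (x j) z))"
      using n that by (intro sum_mono2) (auto intro: Re_damping_nonneg in_ball z)
    then have "- (\<Sum>k<N. Re (damping (x k) (x j) z)) / L \<le> - (\<Sum>k\<in>J. Re (damping (x k) (x j) z)) / L"
      using L_ge_1 by (intro divide_right_mono) auto
    then have "peak (x j) z ^ 4 * (exp 1 / \<delta>) * exp (- (\<Sum>k<N. Re (damping (x k) (x j) z)) / L)
        \<le> peak (x j) z ^ 4 * (exp 1 / \<delta>) * exp (- (\<Sum>k\<in>J. Re (damping (x k) (x j) z)) / L)"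
      using peak_nonneg[OF in_ball] delta_pos by (intro mult_left_mono) auto
    then show ?thesis using norm_partial_beurling_le[OF z, of j N] by linarith
  qed
  then show "\<forall>\<^sub>F N in sequentially. cmod (partial_beurling j N z) \<le> peak (x j) z ^ 4 * (exp 1 / \<delta>)
    * exp (- (\<Sum>k\<in>J. Re (damping (x k) (x j) z)) / L)"
    unfolding eventually_sequentially by blast
qed simp

lemma sum_norm_beurling_le:
  assumes z: "norm z < 1" and J: "finite J"
  shows "(\<Sum>j\<in>J. cmod (beurling j z)) \<le> 16 * exp 1 * L / \<delta>"
proof -
  \<comment> \<open>the factor 4 comes from \<open>Re_damping_ge\<close>, the factor \<open>L\<close> from the exponent of the factors\<close>
  define c where "c = 1 / (4 * L)"
  have c: "0 < c" using L_ge_1 by (simp add: c_def)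
  define A where "A j = (\<Sum>k | k \<in> J \<and> norm (x j) \<le> norm (x k). (peak (x k) z)\<^sup>2)" for j
  have A: "0 \<le> A j" for j by (auto simp: A_def intro: sum_nonneg)
  define D where "D = 4 * (exp 1 / \<delta>)"
  have D: "0 < D" using delta_pos by (simp add: D_def)
  have "cmod (beurling j z) \<le> D * ((peak (x j) z)\<^sup>2 / (1 + c * A j)\<^sup>2)" if j: "j \<in> J" for j
  proof -
    define K where "K = {k \<in> J. norm (x j) \<le> norm (x k)}"
    have K: "finite K" using J by (simp add: K_def)
    define t where "t = peak (x j) z"
    have t: "0 \<le> t" "t \<le> 2"
      unfolding t_def by (rule peak_nonneg[OF in_ball], rule peak_le_2[OF in_ball z])
    have "A j * t / 4 = (\<Sum>k\<in>K. (peak (x k) z)\<^sup>2 * peak (x j) z / 4)"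
      by (simp add: A_def K_def t_def sum_distrib_right sum_divide_distrib)
    also have "\<dots> \<le> (\<Sum>k\<in>K. Re (damping (x k) (x j) z))"
      by (intro sum_mono Re_damping_ge in_ball z) (simp add: K_def)
    finally have "A j * t / 4 / L \<le> (\<Sum>k\<in>K. Re (damping (x k) (x j) z)) / L"
      using L_ge_1 by (intro divide_right_mono) auto
    then have "exp (- (\<Sum>k\<in>K. Re (damping (x k) (x j) z)) / L) \<le> exp (- (c * t * A j))"
      by (simp add: c_def mult_ac)
    then have "t ^ 4 * (exp 1 / \<delta>) * exp (- (\<Sum>k\<in>K. Re (damping (x k) (x j) z)) / L)
        \<le> t ^ 4 * (exp 1 / \<delta>) * exp (- (c * t * A j))"
      using t delta_pos by (intro mult_left_mono) auto
    then have "cmod (beurling j z) \<le> (exp 1 / \<delta>) * (t ^ 4 * exp (- (c * t * A j)))"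
      using norm_beurling_le[OF z K, of j] by (simp add: t_def mult_ac)
    also have "\<dots> \<le> (exp 1 / \<delta>) * (4 * (t\<^sup>2 / (1 + c * A j)\<^sup>2))"
      using delta_pos power_times_exp_le[OF t A c] by (intro mult_left_mono) auto
    finally show ?thesis by (simp add: D_def t_def mult_ac)
  qed
  then have "(\<Sum>j\<in>J. cmod (beurling j z)) \<le> (\<Sum>j\<in>J. D * ((peak (x j) z)\<^sup>2 / (1 + c * A j)\<^sup>2))"
    by (rule sum_mono)
  also have "\<dots> = D * (\<Sum>j\<in>J. (peak (x j) z)\<^sup>2 / (1 + c * A j)\<^sup>2)"
    by (simp only: sum_distrib_left)
  also have "\<dots> \<le> D * (1 / c)"
  proof (rule mult_left_mono)
    define S where "S = (\<Sum>k\<in>J. (peak (x k) z)\<^sup>2)"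
    have "0 \<le> S" by (auto simp: S_def intro: sum_nonneg)
    then have "(1 - 1 / (1 + c * S)) / c \<le> 1 / c"
      using c by (intro divide_right_mono) auto
    then show "(\<Sum>j\<in>J. (peak (x j) z)\<^sup>2 / (1 + c * A j)\<^sup>2) \<le> 1 / c"
      using sum_ordered_le[OF J _ c, of "\<lambda>j. (peak (x j) z)\<^sup>2" "\<lambda>j. norm (x j)"]
      unfolding A_def S_def by simp
  qed (use D in simp)
  also have "\<dots> = 16 * exp 1 * L / \<delta>" by (simp add: D_def c_def)
  finally show ?thesis .
qed

text \<open>\<open>M\<close> bounds \<open>\<Sum>j. cmod (beurling j z)\<close> on the ball.\<close>

definition M :: real
  where "M = 16 * exp 1 * L / \<delta>"

lemma M_pos: "0 < M"
  using L_ge_1 delta_pos by (simp add: M_def)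

lemma summable_beurling:
  assumes z: "norm z < 1"
  shows "summable (\<lambda>j. cmod (beurling j z))"
  by (rule summableI_nonneg_bounded) (auto intro: sum_norm_beurling_le z)

lemma suminf_beurling_le:
  assumes z: "norm z < 1"
  shows "(\<Sum>j. cmod (beurling j z)) \<le> M"
  unfolding M_def by (intro suminf_le_const summable_beurling z sum_norm_beurling_le) simp

lemma beurling_at: "beurling j (x n) = (if j = n then 1 else 0)"
proof (cases "j = n")
  case True
  have "1 - cinner (x n) (x n) \<noteq> 0" by (rule one_minus_cinner_nonzero[OF in_ball in_ball])
  then have "partial_beurling j N (x n) = 1" for N
    using True beurling_factor_self[OF pseudohyp_sq_pos]
    by (simp add: partial_beurling_def flip: one_minus_cinner_self)
  then have "(\<lambda>N. partial_beurling j N (x n)) \<longlonglongrightarrow> 1" by simp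
  then show ?thesis using LIMSEQ_unique[OF tendsto_beurling[OF in_ball]] True by simp
next
  case False
  have "partial_beurling j N (x n) = 0" if "n < N" for N
  proof -
    have "beurling_factor (1 / L) (x j) (x n) (x n) = 0"
      by (rule beurling_factor_zero[OF in_ball in_ball]) (use False inj_x in auto)
    then have "(\<Prod>k<N. beurling_factor (1 / L) (x j) (x k) (x n)) = 0"
      using that by (intro prod_zero) auto
    then show ?thesis by (simp add: partial_beurling_def)
  qed
  then have "\<forall>\<^sub>F N in sequentially. partial_beurling j N (x n) = 0"
    by (rule eventually_mono[OF eventually_gt_at_top[of n]])
  then have "(\<lambda>N. partial_beurling j N (x n)) \<longlonglongrightarrow> 0" by (rule tendsto_eventually)
  then show ?thesis using LIMSEQ_unique[OF tendsto_beurling[OF in_ball]] False by simp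
qed

lemma cfrechet_beurling:
  assumes z: "norm z < 1"
  shows "cfrechet_differentiable_at (beurling j) z"
  by (rule cfrechet_locally_uniform_limit[where f = "partial_beurling j"])
    (use z in \<open>auto intro: cfrechet_partial_beurling uniform_limit_beurling\<close>)

lemma beurling_in_Hinf: "beurling j \<in> Hinf"
proof -
  have "cmod (beurling j z) \<le> M" if "norm z < 1" for z
    using sum_norm_beurling_le[OF that, of "{j}"] by (simp add: M_def)
  then show ?thesis
    unfolding Hinf_def bounded_iff using cfrechet_beurling by (auto intro!: exI[of _ M])
qed

lemma beurling_functions_beurling: "beurling_functions x beurling"
  unfolding beurling_functions_def
  using beurling_in_Hinf beurling_at M_pos summable_beurling suminf_beurling_le by auto

text \<open>The series \<open>\<Sum>j. a j * beurling j\<close> converges uniformly on smaller balls, since there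
  \<open>beurling j\<close> is bounded by a multiple of \<open>defect (x j)\<close>.\<close>

lemma interpolation:
  assumes a: "\<And>j. cmod (a j) \<le> C" and C: "0 \<le> C"
  obtains f where "f \<in> Hinf" "\<And>n. f (x n) = a n" "\<And>z. z \<in> ball 0 1 \<Longrightarrow> cmod (f z) \<le> C * M"
proof
  define f where "f z = (\<Sum>j. a j * beurling j z)" for z
  have unif: "uniform_limit (ball 0 r) (\<lambda>n z. \<Sum>j<n. a j * beurling j z) f sequentially"
    if r: "r < 1" for r
    unfolding f_def
  proof (rule Weierstrass_m_test)
    define B where "B = C * (exp 1 / \<delta>) / (1 - r) ^ 4"
    fix j and z :: 'a assume "z \<in> ball 0 r"
    then have z: "norm z \<le> r" "norm z < 1" using r by auto
    have d: "0 < defect (x j)" "defect (x j) \<le> 1" using defect_pos[OF in_ball] defect_le_1 by auto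
    have "peak (x j) z ^ 4 \<le> (defect (x j) / (1 - r)) ^ 4"
      using peak_le[OF in_ball z(1) r] peak_nonneg[OF in_ball] by (intro power_mono) auto
    also have "\<dots> \<le> defect (x j) / (1 - r) ^ 4"
      using d r power_decreasing[of 1 4 "defect (x j)"]
      by (simp add: power_divide divide_right_mono)
    finally have "peak (x j) z ^ 4 * (exp 1 / \<delta>) \<le> defect (x j) / (1 - r) ^ 4 * (exp 1 / \<delta>)"
      using delta_pos by (intro mult_right_mono) auto
    then have "cmod (beurling j z) \<le> defect (x j) / (1 - r) ^ 4 * (exp 1 / \<delta>)"
      using norm_beurling_le'[OF z(2), of j] by linarith
    then have "cmod (a j * beurling j z) \<le> C * (defect (x j) / (1 - r) ^ 4 * (exp 1 / \<delta>))"
      unfolding norm_mult using a C by (intro mult_mono) auto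
    then show "cmod (a j * beurling j z) \<le> B * defect (x j)"
      by (simp add: B_def mult_ac)
  next
    show "summable (\<lambda>j. C * (exp 1 / \<delta>) / (1 - r) ^ 4 * defect (x j))"
      by (intro summable_mult separated_summable_defect[OF in_ball separated delta_pos])
  qed
  have diff: "cfrechet_differentiable_at f z" if "z \<in> ball 0 1" for z
    by (rule cfrechet_locally_uniform_limit[where f = "\<lambda>n z. \<Sum>j<n. a j * beurling j z"])
      (use that unif in \<open>auto intro!: cfrechet_sum cfrechet_mult cfrechet_const cfrechet_beurling\<close>)
  show bound: "cmod (f z) \<le> C * M" if "z \<in> ball 0 1" for z
  proof -
    have z: "norm z < 1" using that by simp
    have le: "cmod (a j * beurling j z) \<le> C * cmod (beurling j z)" for j
      using a by (simp add: norm_mult mult_right_mono)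
    have s: "summable (\<lambda>j. C * cmod (beurling j z))"
      by (intro summable_mult summable_beurling z)
    have s': "summable (\<lambda>j. cmod (a j * beurling j z))"
      by (rule summable_comparison_test'[OF s, of 0]) (use le in simp)
    have "cmod (f z) \<le> (\<Sum>j. cmod (a j * beurling j z))"
      unfolding f_def by (rule summable_norm[OF s'])
    also have "\<dots> \<le> (\<Sum>j. C * cmod (beurling j z))" by (rule suminf_le[OF le s' s])
    also have "\<dots> = C * (\<Sum>j. cmod (beurling j z))"
      by (rule suminf_mult[OF summable_beurling[OF z]])
    also have "\<dots> \<le> C * M" by (intro mult_left_mono suminf_beurling_le z C)
    finally show ?thesis .
  qed
  show "f \<in> Hinf"
    unfolding Hinf_def bounded_iff using diff bound by (auto intro!: exI[of _ "C * M"])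
  show "f (x n) = a n" for n
  proof -
    have "(\<lambda>j. a j * beurling j (x n)) sums a n"
      using sums_single[of n a] by (simp add: beurling_at if_distrib cong: if_cong)
    then show ?thesis unfolding f_def by (rule sums_unique[symmetric])
  qed
qed

lemma M_le: "M \<le> 128 * (1 + 2 * ln (1 / \<delta>)) / (exp 1 * \<delta>)"
proof -
  have "exp 1 * exp 1 \<le> (272/100) * (272/100 :: real)"
    using e_less_272 by (intro mult_mono) auto
  then have "exp 1 * exp 1 \<le> (8::real)" by simp
  then have "(exp 1 * exp 1) * (16 * L) \<le> 8 * (16 * L)"
    using L_ge_1 by (intro mult_right_mono) auto
  then have "16 * exp 1 * L \<le> 128 * L / exp 1"
    by (simp add: field_simps)
  then have "16 * exp 1 * L / \<delta> \<le> 128 * L / exp 1 / \<delta>"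
    using delta_pos by (intro divide_right_mono) auto
  then show ?thesis by (simp add: M_def L_def)
qed

lemma interpolating_x: "interpolating x"
  unfolding interpolating_def
proof (intro allI impI)
  fix a :: "nat \<Rightarrow> complex" assume "bounded (range a)"
  then obtain C where C: "\<And>j. cmod (a j) \<le> C" by (auto simp: bounded_iff)
  have C0: "0 \<le> C" using C[of 0] norm_ge_zero[of "a 0"] by linarith
  show "\<exists>f\<in>Hinf. \<forall>n. f (x n) = a n" by (rule interpolation[of a, OF C C0]) blast
qed

lemma interpolation_constant_le: "interpolation_constant x \<le> ereal M"
  unfolding interpolation_constant_def
proof (rule SUP_least)
  fix \<alpha> :: "nat \<Rightarrow> complex"
  assume "\<alpha> \<in> {\<alpha>. bounded (range \<alpha>) \<and> (SUP j. cmod (\<alpha> j)) \<le> 1}"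
  then have bdd: "bounded (range \<alpha>)" and sup: "(SUP j. cmod (\<alpha> j)) \<le> 1" by auto
  from bdd obtain C where "\<And>j. cmod (\<alpha> j) \<le> C" by (auto simp: bounded_iff)
  then have "bdd_above (range (\<lambda>j. cmod (\<alpha> j)))" by (intro bdd_aboveI2)
  then have "cmod (\<alpha> j) \<le> 1" for j
    using cSUP_upper[of j UNIV "\<lambda>j. cmod (\<alpha> j)"] sup by (meson UNIV_I order_trans)
  then obtain f where f: "f \<in> Hinf" "\<And>n. f (x n) = \<alpha> n" "\<And>z. z \<in> ball 0 1 \<Longrightarrow> cmod (f z) \<le> M"
    using interpolation[of \<alpha> 1] by auto
  have "min_interpolation_norm x \<alpha> \<le> ereal (Hinf_norm f)"
    unfolding min_interpolation_norm_def using f by (intro INF_lower) auto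
  also have "\<dots> \<le> ereal M" using Hinf_norm_le[OF f(3)] by simp
  finally show "min_interpolation_norm x \<alpha> \<le> ereal M" .
qed

end

theorem theorem3p11:
  fixes x :: "nat \<Rightarrow> 'a::chilbert_space" and \<delta> :: real
  assumes "\<And>n. x n \<in> ball 0 1"
    and "\<delta> > 0"
    and "uniformly_separated \<delta> x"
  shows "(\<exists>F. beurling_functions x F) \<and>
    interpolating x \<and>
    interpolation_constant x \<le> ereal (128 * (1 + 2 * ln (1 / \<delta>)) / (exp 1 * \<delta>))"
proof -
  interpret separated_sequence x \<delta>
    by unfold_locales (use assms in auto)
  have "interpolation_constant x \<le> ereal (128 * (1 + 2 * ln (1 / \<delta>)) / (exp 1 * \<delta>))"
    using interpolation_constant_le M_le by (meson ereal_less_eq(3) order_trans)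
  then show ?thesis using beurling_functions_beurling interpolating_x by blast
qed

end
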